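(* Let $F\colon\mathcal{A}\to\mathcal{B}$ be an additive functor between two abelian categories. Assume that $F$ admits a right adjoint $U\colon\mathcal{B}\to\mathcal{A}$ which is exact. Denote by $M$ the monad on $\mathcal{A}$ defined by the adjoint pair $(F,U)$. Then the comparison functor $K\colon\mathcal{B}\to M\text{-}\mathrm{Mod}_{\mathcal{A}}$ is an equivalence if and only if the functor $U\colon\mathcal{B}\to\mathcal{A}$ is faithful.
   Context: Let $(F,U;\eta,\epsilon)$ be the adjoint pair, with unit $\eta\colon\mathrm{Id}_{\mathcal{A}}\to UF$ and counit $\epsilon\colon FU\to\mathrm{Id}_{\mathcal{B}}$. The monad it defines is $(M,\eta,\mu)$ with $M=UF$ and $\mu=U\epsilon F\colon M^2\to M$. An $M$-module is a pair $(X,\lambda)$ with $X\in\mathcal{A}$ and $\lambda\colon M(X)\to X$ satisfying $\lambda\circ M(\lambda)=\lambda\circ\mu_X$ and $\lambda\circ\eta_X=\mathrm{Id}_X$; a morphism $(X,\lambda)\to(X',\lambda')$ is a morphism $f\colon X\to X'$ with $f\circ\lambda=\lambda'\circ M(f)$. These form the category $M\text{-}\mathrm{Mod}_{\mathcal{A}}$ (the Eilenberg–Moore category). The comparison functor $K$ is given by $K(B)=(U(B),U\epsilon_B)$ on objects and $K(f)=U(f)$ on morphisms. *)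

theory Defs
  imports "HOL-Algebra.Group"
begin

section \<open>Categories, functors, natural transformations\<close>

record ('o, 'm) cat =
  Obj :: "'o set"
  Arr :: "'m set"
  Src :: "'m \<Rightarrow> 'o"
  Tgt :: "'m \<Rightarrow> 'o"
  Ide :: "'o \<Rightarrow> 'm"
  Comp :: "'m \<Rightarrow> 'm \<Rightarrow> 'm"  (infixr \<open>\<cdot>\<index>\<close> 70)

text \<open>\<open>g \<cdot>\<^bsub>C\<^esub> f\<close> means ``\<open>g\<close> after \<open>f\<close>''.\<close>

definition Hom :: "('o, 'm, 'x) cat_scheme \<Rightarrow> 'o \<Rightarrow> 'o \<Rightarrow> 'm set" where
  "Hom C X Y = {f \<in> Arr C. Src C f = X \<and> Tgt C f = Y}"

locale category =
  fixes C :: "('o, 'm, 'x) cat_scheme" (structure)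
  assumes src_obj: "f \<in> Arr C \<Longrightarrow> Src C f \<in> Obj C"
    and tgt_obj: "f \<in> Arr C \<Longrightarrow> Tgt C f \<in> Obj C"
    and ide_hom: "X \<in> Obj C \<Longrightarrow> Ide C X \<in> Hom C X X"
    and comp_hom: "\<lbrakk>f \<in> Hom C X Y; g \<in> Hom C Y Z\<rbrakk> \<Longrightarrow> g \<cdot> f \<in> Hom C X Z"
    and comp_ide: "f \<in> Hom C X Y \<Longrightarrow> f \<cdot> Ide C X = f"
    and ide_comp: "f \<in> Hom C X Y \<Longrightarrow> Ide C Y \<cdot> f = f"
    and comp_assoc: "\<lbrakk>f \<in> Hom C W X; g \<in> Hom C X Y; h \<in> Hom C Y Z\<rbrakk>
                       \<Longrightarrow> (h \<cdot> g) \<cdot> f = h \<cdot> (g \<cdot> f)"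

record ('o, 'm, 'p, 'n) ftor =
  on_obj :: "'o \<Rightarrow> 'p"
  on_arr :: "'m \<Rightarrow> 'n"

definition is_functor ::
  "('o, 'm, 'x) cat_scheme \<Rightarrow> ('p, 'n, 'y) cat_scheme \<Rightarrow> ('o, 'm, 'p, 'n) ftor \<Rightarrow> bool" where
  "is_functor C D F \<longleftrightarrow> category C \<and> category D
     \<and> (\<forall>X\<in>Obj C. on_obj F X \<in> Obj D)
     \<and> (\<forall>X\<in>Obj C. \<forall>Y\<in>Obj C. \<forall>f\<in>Hom C X Y. on_arr F f \<in> Hom D (on_obj F X) (on_obj F Y))
     \<and> (\<forall>X\<in>Obj C. on_arr F (Ide C X) = Ide D (on_obj F X))
     \<and> (\<forall>X\<in>Obj C. \<forall>Y\<in>Obj C. \<forall>Z\<in>Obj C. \<forall>f\<in>Hom C X Y. \<forall>g\<in>Hom C Y Z.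
          on_arr F (g \<cdot>\<^bsub>C\<^esub> f) = on_arr F g \<cdot>\<^bsub>D\<^esub> on_arr F f)"

definition id_ftor :: "('o, 'm, 'o, 'm) ftor" where
  "id_ftor = \<lparr>on_obj = (\<lambda>X. X), on_arr = (\<lambda>f. f)\<rparr>"

definition comp_ftor ::
  "('p, 'n, 'q, 'l) ftor \<Rightarrow> ('o, 'm, 'p, 'n) ftor \<Rightarrow> ('o, 'm, 'q, 'l) ftor"
  (infixr \<open>\<circ>\<^sub>F\<close> 75) where
  "G \<circ>\<^sub>F F = \<lparr>on_obj = (\<lambda>X. on_obj G (on_obj F X)), on_arr = (\<lambda>f. on_arr G (on_arr F f))\<rparr>"

definition is_iso :: "('o, 'm, 'x) cat_scheme \<Rightarrow> 'm \<Rightarrow> bool" where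
  "is_iso C f \<longleftrightarrow> f \<in> Arr C \<and>
     (\<exists>g\<in>Hom C (Tgt C f) (Src C f). g \<cdot>\<^bsub>C\<^esub> f = Ide C (Src C f) \<and> f \<cdot>\<^bsub>C\<^esub> g = Ide C (Tgt C f))"

definition nat_trans ::
  "('o, 'm, 'x) cat_scheme \<Rightarrow> ('p, 'n, 'y) cat_scheme
     \<Rightarrow> ('o, 'm, 'p, 'n) ftor \<Rightarrow> ('o, 'm, 'p, 'n) ftor \<Rightarrow> ('o \<Rightarrow> 'n) \<Rightarrow> bool" where
  "nat_trans C D F G \<tau> \<longleftrightarrow> is_functor C D F \<and> is_functor C D G
     \<and> (\<forall>X\<in>Obj C. \<tau> X \<in> Hom D (on_obj F X) (on_obj G X))
     \<and> (\<forall>X\<in>Obj C. \<forall>Y\<in>Obj C. \<forall>f\<in>Hom C X Y.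
          \<tau> Y \<cdot>\<^bsub>D\<^esub> on_arr F f = on_arr G f \<cdot>\<^bsub>D\<^esub> \<tau> X)"

definition nat_iso ::
  "('o, 'm, 'x) cat_scheme \<Rightarrow> ('p, 'n, 'y) cat_scheme
     \<Rightarrow> ('o, 'm, 'p, 'n) ftor \<Rightarrow> ('o, 'm, 'p, 'n) ftor \<Rightarrow> ('o \<Rightarrow> 'n) \<Rightarrow> bool" where
  "nat_iso C D F G \<tau> \<longleftrightarrow> nat_trans C D F G \<tau> \<and> (\<forall>X\<in>Obj C. is_iso D (\<tau> X))"

definition faithful_functor ::
  "('o, 'm, 'x) cat_scheme \<Rightarrow> ('p, 'n, 'y) cat_scheme \<Rightarrow> ('o, 'm, 'p, 'n) ftor \<Rightarrow> bool" where
  "faithful_functor C D F \<longleftrightarrow> is_functor C D F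
     \<and> (\<forall>X\<in>Obj C. \<forall>Y\<in>Obj C. inj_on (on_arr F) (Hom C X Y))"

definition equivalence_functor ::
  "('o, 'm, 'x) cat_scheme \<Rightarrow> ('p, 'n, 'y) cat_scheme \<Rightarrow> ('o, 'm, 'p, 'n) ftor \<Rightarrow> bool" where
  "equivalence_functor C D F \<longleftrightarrow> is_functor C D F
     \<and> (\<exists>G \<alpha> \<beta>. is_functor D C G
          \<and> nat_iso C C id_ftor (G \<circ>\<^sub>F F) \<alpha> \<and> nat_iso D D (F \<circ>\<^sub>F G) id_ftor \<beta>)"


section \<open>Abelian categories and exact functors\<close>

record ('o, 'm) addcat = "('o, 'm) cat" +
  Plus :: "'m \<Rightarrow> 'm \<Rightarrow> 'm"  (infixl \<open>\<boxplus>\<index>\<close> 65)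
  Zero :: "'o \<Rightarrow> 'o \<Rightarrow> 'm"

definition HomGroup :: "('o, 'm, 'x) addcat_scheme \<Rightarrow> 'o \<Rightarrow> 'o \<Rightarrow> 'm monoid" where
  "HomGroup C X Y = \<lparr>carrier = Hom C X Y, mult = Plus C, one = Zero C X Y\<rparr>"

locale preadditive_category = category C
  for C :: "('o, 'm, 'x) addcat_scheme" (structure) +
  assumes hom_group: "\<lbrakk>X \<in> Obj C; Y \<in> Obj C\<rbrakk> \<Longrightarrow> comm_group (HomGroup C X Y)"
    and comp_plus: "\<lbrakk>f \<in> Hom C X Y; f' \<in> Hom C X Y; g \<in> Hom C Y Z\<rbrakk>
                      \<Longrightarrow> g \<cdot> (f \<boxplus> f') = (g \<cdot> f) \<boxplus> (g \<cdot> f')"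
    and plus_comp: "\<lbrakk>f \<in> Hom C X Y; g \<in> Hom C Y Z; g' \<in> Hom C Y Z\<rbrakk>
                      \<Longrightarrow> (g \<boxplus> g') \<cdot> f = (g \<cdot> f) \<boxplus> (g' \<cdot> f)"

definition is_zero_object :: "('o, 'm, 'x) cat_scheme \<Rightarrow> 'o \<Rightarrow> bool" where
  "is_zero_object C N \<longleftrightarrow> N \<in> Obj C
     \<and> (\<forall>X\<in>Obj C. (\<exists>!f. f \<in> Hom C X N) \<and> (\<exists>!f. f \<in> Hom C N X))"

definition is_biproduct ::
  "('o, 'm, 'x) addcat_scheme \<Rightarrow> 'o \<Rightarrow> 'o \<Rightarrow> 'o \<Rightarrow> 'm \<Rightarrow> 'm \<Rightarrow> 'm \<Rightarrow> 'm \<Rightarrow> bool" where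
  "is_biproduct C X Y S i j p q \<longleftrightarrow> S \<in> Obj C
     \<and> i \<in> Hom C X S \<and> j \<in> Hom C Y S \<and> p \<in> Hom C S X \<and> q \<in> Hom C S Y
     \<and> p \<cdot>\<^bsub>C\<^esub> i = Ide C X \<and> q \<cdot>\<^bsub>C\<^esub> j = Ide C Y
     \<and> p \<cdot>\<^bsub>C\<^esub> j = Zero C Y X \<and> q \<cdot>\<^bsub>C\<^esub> i = Zero C X Y
     \<and> (i \<cdot>\<^bsub>C\<^esub> p) \<boxplus>\<^bsub>C\<^esub> (j \<cdot>\<^bsub>C\<^esub> q) = Ide C S"

locale additive_category = preadditive_category C
  for C :: "('o, 'm, 'x) addcat_scheme" (structure) +
  assumes zero_object: "\<exists>N. is_zero_object C N"
    and biproducts: "\<lbrakk>X \<in> Obj C; Y \<in> Obj C\<rbrakk> \<Longrightarrow> \<exists>S i j p q. is_biproduct C X Y S i j p q"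

definition is_mono :: "('o, 'm, 'x) cat_scheme \<Rightarrow> 'm \<Rightarrow> bool" where
  "is_mono C f \<longleftrightarrow> f \<in> Arr C \<and>
     (\<forall>W\<in>Obj C. \<forall>g\<in>Hom C W (Src C f). \<forall>h\<in>Hom C W (Src C f).
        f \<cdot>\<^bsub>C\<^esub> g = f \<cdot>\<^bsub>C\<^esub> h \<longrightarrow> g = h)"

definition is_epi :: "('o, 'm, 'x) cat_scheme \<Rightarrow> 'm \<Rightarrow> bool" where
  "is_epi C f \<longleftrightarrow> f \<in> Arr C \<and>
     (\<forall>W\<in>Obj C. \<forall>g\<in>Hom C (Tgt C f) W. \<forall>h\<in>Hom C (Tgt C f) W.
        g \<cdot>\<^bsub>C\<^esub> f = h \<cdot>\<^bsub>C\<^esub> f \<longrightarrow> g = h)"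

definition is_kernel :: "('o, 'm, 'x) addcat_scheme \<Rightarrow> 'm \<Rightarrow> 'm \<Rightarrow> bool" where
  "is_kernel C k f \<longleftrightarrow> f \<in> Arr C \<and> k \<in> Arr C \<and> Tgt C k = Src C f
     \<and> f \<cdot>\<^bsub>C\<^esub> k = Zero C (Src C k) (Tgt C f)
     \<and> (\<forall>W\<in>Obj C. \<forall>h\<in>Hom C W (Src C f). f \<cdot>\<^bsub>C\<^esub> h = Zero C W (Tgt C f)
          \<longrightarrow> (\<exists>!u. u \<in> Hom C W (Src C k) \<and> k \<cdot>\<^bsub>C\<^esub> u = h))"

definition is_cokernel :: "('o, 'm, 'x) addcat_scheme \<Rightarrow> 'm \<Rightarrow> 'm \<Rightarrow> bool" where
  "is_cokernel C c f \<longleftrightarrow> f \<in> Arr C \<and> c \<in> Arr C \<and> Src C c = Tgt C f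
     \<and> c \<cdot>\<^bsub>C\<^esub> f = Zero C (Src C f) (Tgt C c)
     \<and> (\<forall>W\<in>Obj C. \<forall>h\<in>Hom C (Tgt C f) W. h \<cdot>\<^bsub>C\<^esub> f = Zero C (Src C f) W
          \<longrightarrow> (\<exists>!u. u \<in> Hom C (Tgt C c) W \<and> u \<cdot>\<^bsub>C\<^esub> c = h))"

locale abelian_category = additive_category C
  for C :: "('o, 'm, 'x) addcat_scheme" (structure) +
  assumes kernels: "f \<in> Arr C \<Longrightarrow> \<exists>k. is_kernel C k f"
    and cokernels: "f \<in> Arr C \<Longrightarrow> \<exists>c. is_cokernel C c f"
    and mono_normal: "is_mono C f \<Longrightarrow> \<exists>g. is_kernel C f g"
    and epi_normal: "is_epi C f \<Longrightarrow> \<exists>g. is_cokernel C f g"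

definition additive_functor ::
  "('o, 'm, 'x) addcat_scheme \<Rightarrow> ('p, 'n, 'y) addcat_scheme \<Rightarrow> ('o, 'm, 'p, 'n) ftor \<Rightarrow> bool" where
  "additive_functor C D F \<longleftrightarrow> is_functor C D F
     \<and> (\<forall>X\<in>Obj C. \<forall>Y\<in>Obj C.
          on_arr F \<in> hom (HomGroup C X Y) (HomGroup D (on_obj F X) (on_obj F Y)))"

text \<open>The image is the kernel of the cokernel; a sequence
  \<open>\<bullet> \<rightarrow> \<bullet> \<rightarrow> \<bullet>\<close> given by \<open>f\<close> and then \<open>g\<close> is exact when
  the image of \<open>f\<close> and the kernel of \<open>g\<close> are the same subobject of the middle term.\<close>

definition is_image :: "('o, 'm, 'x) addcat_scheme \<Rightarrow> 'm \<Rightarrow> 'm \<Rightarrow> bool" where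
  "is_image C i f \<longleftrightarrow> (\<exists>c. is_cokernel C c f \<and> is_kernel C i c)"

definition exact_pair :: "('o, 'm, 'x) addcat_scheme \<Rightarrow> 'm \<Rightarrow> 'm \<Rightarrow> bool" where
  "exact_pair C f g \<longleftrightarrow> (\<exists>i. is_image C i f \<and> is_kernel C i g)"

definition short_exact :: "('o, 'm, 'x) addcat_scheme \<Rightarrow> 'm \<Rightarrow> 'm \<Rightarrow> bool" where
  "short_exact C f g \<longleftrightarrow> is_mono C f \<and> exact_pair C f g \<and> is_epi C g"

definition exact_functor ::
  "('o, 'm, 'x) addcat_scheme \<Rightarrow> ('p, 'n, 'y) addcat_scheme \<Rightarrow> ('o, 'm, 'p, 'n) ftor \<Rightarrow> bool" where
  "exact_functor C D F \<longleftrightarrow> additive_functor C D F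
     \<and> (\<forall>f g. short_exact C f g \<longrightarrow> short_exact D (on_arr F f) (on_arr F g))"


section \<open>Adjoint pairs, monads, modules and the comparison functor\<close>

definition adjoint_pair ::
  "('o, 'm, 'x) cat_scheme \<Rightarrow> ('p, 'n, 'y) cat_scheme \<Rightarrow> ('o, 'm, 'p, 'n) ftor
     \<Rightarrow> ('p, 'n, 'o, 'm) ftor \<Rightarrow> ('o \<Rightarrow> 'm) \<Rightarrow> ('p \<Rightarrow> 'n) \<Rightarrow> bool" where
  "adjoint_pair A B F U \<eta> \<epsilon> \<longleftrightarrow> is_functor A B F \<and> is_functor B A U
     \<and> nat_trans A A id_ftor (U \<circ>\<^sub>F F) \<eta> \<and> nat_trans B B (F \<circ>\<^sub>F U) id_ftor \<epsilon>
     \<and> (\<forall>X\<in>Obj A. \<epsilon> (on_obj F X) \<cdot>\<^bsub>B\<^esub> on_arr F (\<eta> X) = Ide B (on_obj F X))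
     \<and> (\<forall>Y\<in>Obj B. on_arr U (\<epsilon> Y) \<cdot>\<^bsub>A\<^esub> \<eta> (on_obj U Y) = Ide A (on_obj U Y))"

record ('o, 'm) monad =
  endo :: "('o, 'm, 'o, 'm) ftor"
  unit :: "'o \<Rightarrow> 'm"
  mu :: "'o \<Rightarrow> 'm"

definition is_monad :: "('o, 'm, 'x) cat_scheme \<Rightarrow> ('o, 'm) monad \<Rightarrow> bool" where
  "is_monad A M \<longleftrightarrow> is_functor A A (endo M)
     \<and> nat_trans A A id_ftor (endo M) (unit M)
     \<and> nat_trans A A (endo M \<circ>\<^sub>F endo M) (endo M) (mu M)
     \<and> (\<forall>X\<in>Obj A. mu M X \<cdot>\<^bsub>A\<^esub> on_arr (endo M) (mu M X) = mu M X \<cdot>\<^bsub>A\<^esub> mu M (on_obj (endo M) X))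
     \<and> (\<forall>X\<in>Obj A. mu M X \<cdot>\<^bsub>A\<^esub> on_arr (endo M) (unit M X) = Ide A (on_obj (endo M) X))
     \<and> (\<forall>X\<in>Obj A. mu M X \<cdot>\<^bsub>A\<^esub> unit M (on_obj (endo M) X) = Ide A (on_obj (endo M) X))"

definition adj_monad ::
  "('o, 'm, 'p, 'n) ftor \<Rightarrow> ('p, 'n, 'o, 'm) ftor \<Rightarrow> ('o \<Rightarrow> 'm) \<Rightarrow> ('p \<Rightarrow> 'n) \<Rightarrow> ('o, 'm) monad" where
  "adj_monad F U \<eta> \<epsilon> =
     \<lparr>endo = U \<circ>\<^sub>F F, unit = \<eta>, mu = (\<lambda>X. on_arr U (\<epsilon> (on_obj F X)))\<rparr>"

definition modules :: "('o, 'm, 'x) cat_scheme \<Rightarrow> ('o, 'm) monad \<Rightarrow> ('o \<times> 'm) set" where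
  "modules A M = {(X, l). X \<in> Obj A \<and> l \<in> Hom A (on_obj (endo M) X) X
     \<and> l \<cdot>\<^bsub>A\<^esub> on_arr (endo M) l = l \<cdot>\<^bsub>A\<^esub> mu M X
     \<and> l \<cdot>\<^bsub>A\<^esub> unit M X = Ide A X}"

definition is_module_morphism ::
  "('o, 'm, 'x) cat_scheme \<Rightarrow> ('o, 'm) monad \<Rightarrow> 'o \<times> 'm \<Rightarrow> 'o \<times> 'm \<Rightarrow> 'm \<Rightarrow> bool" where
  "is_module_morphism A M P Q f \<longleftrightarrow> f \<in> Hom A (fst P) (fst Q)
     \<and> f \<cdot>\<^bsub>A\<^esub> snd P = snd Q \<cdot>\<^bsub>A\<^esub> on_arr (endo M) f"

text \<open>An arrow of the module category carries its source and target, since the underlying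
  arrow of the base category does not determine the two module structures.\<close>

definition Mod_cat ::
  "('o, 'm, 'x) cat_scheme \<Rightarrow> ('o, 'm) monad
     \<Rightarrow> ('o \<times> 'm, ('o \<times> 'm) \<times> 'm \<times> ('o \<times> 'm)) cat" where
  "Mod_cat A M =
     \<lparr>Obj = modules A M,
      Arr = {(P, f, Q). P \<in> modules A M \<and> Q \<in> modules A M \<and> is_module_morphism A M P Q f},
      Src = (\<lambda>(P, f, Q). P),
      Tgt = (\<lambda>(P, f, Q). Q),
      Ide = (\<lambda>P. (P, Ide A (fst P), P)),
      Comp = (\<lambda>(Q', g, R) (P, f, Q). (P, g \<cdot>\<^bsub>A\<^esub> f, R))\<rparr>"

definition comparison_obj :: "('p, 'n, 'o, 'm) ftor \<Rightarrow> ('p \<Rightarrow> 'n) \<Rightarrow> 'p \<Rightarrow> 'o \<times> 'm" where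
  "comparison_obj U \<epsilon> Y = (on_obj U Y, on_arr U (\<epsilon> Y))"

definition comparison ::
  "('p, 'n, 'y) cat_scheme \<Rightarrow> ('p, 'n, 'o, 'm) ftor \<Rightarrow> ('p \<Rightarrow> 'n)
     \<Rightarrow> ('p, 'n, 'o \<times> 'm, ('o \<times> 'm) \<times> 'm \<times> ('o \<times> 'm)) ftor" where
  "comparison B U \<epsilon> =
     \<lparr>on_obj = comparison_obj U \<epsilon>,
      on_arr = (\<lambda>f. (comparison_obj U \<epsilon> (Src B f), on_arr U f, comparison_obj U \<epsilon> (Tgt B f)))\<rparr>"


section \<open>The constructions are well defined\<close>

lemma is_functorD:
  assumes "is_functor C D F"
  shows "category C" "category D"
    "X \<in> Obj C \<Longrightarrow> on_obj F X \<in> Obj D"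
    "f \<in> Hom C X Y \<Longrightarrow> on_arr F f \<in> Hom D (on_obj F X) (on_obj F Y)"
    "X \<in> Obj C \<Longrightarrow> on_arr F (Ide C X) = Ide D (on_obj F X)"
    "\<lbrakk>f \<in> Hom C X Y; g \<in> Hom C Y Z\<rbrakk> \<Longrightarrow> on_arr F (g \<cdot>\<^bsub>C\<^esub> f) = on_arr F g \<cdot>\<^bsub>D\<^esub> on_arr F f"
proof -
  have C: "category C" using assms by (simp add: is_functor_def)
  have H: "X \<in> Obj C \<and> Y \<in> Obj C" if "f \<in> Hom C X Y" for f X Y
    using that category.src_obj[OF C] category.tgt_obj[OF C] by (auto simp: Hom_def)
  show "category C" "category D" "X \<in> Obj C \<Longrightarrow> on_obj F X \<in> Obj D"
    "X \<in> Obj C \<Longrightarrow> on_arr F (Ide C X) = Ide D (on_obj F X)"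
    using assms by (auto simp: is_functor_def)
  show "f \<in> Hom C X Y \<Longrightarrow> on_arr F f \<in> Hom D (on_obj F X) (on_obj F Y)"
    using assms H[of f X Y] by (auto simp: is_functor_def)
  show "\<lbrakk>f \<in> Hom C X Y; g \<in> Hom C Y Z\<rbrakk> \<Longrightarrow> on_arr F (g \<cdot>\<^bsub>C\<^esub> f) = on_arr F g \<cdot>\<^bsub>D\<^esub> on_arr F f"
    using assms H[of f X Y] H[of g Y Z] unfolding is_functor_def by blast
qed

lemma nat_transD:
  assumes "nat_trans C D F G \<tau>"
  shows "is_functor C D F" "is_functor C D G"
    "X \<in> Obj C \<Longrightarrow> \<tau> X \<in> Hom D (on_obj F X) (on_obj G X)"
    "f \<in> Hom C X Y \<Longrightarrow> \<tau> Y \<cdot>\<^bsub>D\<^esub> on_arr F f = on_arr G f \<cdot>\<^bsub>D\<^esub> \<tau> X"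
proof -
  have C: "category C" using assms by (simp add: nat_trans_def is_functor_def)
  have H: "X \<in> Obj C \<and> Y \<in> Obj C" if "f \<in> Hom C X Y" for f X Y
    using that category.src_obj[OF C] category.tgt_obj[OF C] by (auto simp: Hom_def)
  show "is_functor C D F" "is_functor C D G"
    "X \<in> Obj C \<Longrightarrow> \<tau> X \<in> Hom D (on_obj F X) (on_obj G X)"
    using assms by (auto simp: nat_trans_def)
  show "f \<in> Hom C X Y \<Longrightarrow> \<tau> Y \<cdot>\<^bsub>D\<^esub> on_arr F f = on_arr G f \<cdot>\<^bsub>D\<^esub> \<tau> X"
    using assms H[of f X Y] unfolding nat_trans_def by blast
qed

lemma comp_ftor_simps [simp]:
  "on_obj (G \<circ>\<^sub>F F) X = on_obj G (on_obj F X)"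
  "on_arr (G \<circ>\<^sub>F F) f = on_arr G (on_arr F f)"
  "on_obj id_ftor X = X" "on_arr id_ftor h = h"
  by (simp_all add: comp_ftor_def id_ftor_def)

lemma is_functor_comp:
  assumes F: "is_functor C D F" and G: "is_functor D E G"
  shows "is_functor C E (G \<circ>\<^sub>F F)"
  unfolding is_functor_def
  using is_functorD(1)[OF F] is_functorD(2)[OF G]
  by (auto simp: is_functorD(5)[OF F] is_functorD(5)[OF G] is_functorD(3)[OF F]
      is_functorD(6)[OF F] is_functorD(6)[OF G is_functorD(4)[OF F] is_functorD(4)[OF F]]
      intro!: is_functorD(3)[OF G] is_functorD(4)[OF G] is_functorD(4)[OF F])

lemma adj_monad_is_monad:
  assumes "adjoint_pair A B F U \<eta> \<epsilon>"
  shows "is_monad A (adj_monad F U \<eta> \<epsilon>)"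
proof -
  have F: "is_functor A B F" and U: "is_functor B A U"
    and e: "nat_trans A A id_ftor (U \<circ>\<^sub>F F) \<eta>"
    and d: "nat_trans B B (F \<circ>\<^sub>F U) id_ftor \<epsilon>"
    and t1: "\<And>X. X \<in> Obj A \<Longrightarrow> \<epsilon> (on_obj F X) \<cdot>\<^bsub>B\<^esub> on_arr F (\<eta> X) = Ide B (on_obj F X)"
    and t2: "\<And>Y. Y \<in> Obj B \<Longrightarrow> on_arr U (\<epsilon> Y) \<cdot>\<^bsub>A\<^esub> \<eta> (on_obj U Y) = Ide A (on_obj U Y)"
    using assms by (auto simp: adjoint_pair_def)
  note Fs = is_functorD[OF F] and Us = is_functorD[OF U]
  have eh: "\<eta> X \<in> Hom A X (on_obj U (on_obj F X))" if "X \<in> Obj A" for X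
    using nat_transD(3)[OF e that] by simp
  have dh: "\<epsilon> Y \<in> Hom B (on_obj F (on_obj U Y)) Y" if "Y \<in> Obj B" for Y
    using nat_transD(3)[OF d that] by simp
  have dn: "\<epsilon> Y' \<cdot>\<^bsub>B\<^esub> on_arr F (on_arr U g) = g \<cdot>\<^bsub>B\<^esub> \<epsilon> Y" if "g \<in> Hom B Y Y'" for g Y Y'
    using nat_transD(4)[OF d that] by simp
  have UF: "is_functor A A (U \<circ>\<^sub>F F)" using is_functor_comp[OF F U] .
  have dn': "on_arr U (\<epsilon> Y') \<cdot>\<^bsub>A\<^esub> on_arr U (on_arr F (on_arr U g)) = on_arr U g \<cdot>\<^bsub>A\<^esub> on_arr U (\<epsilon> Y)"
    if g: "g \<in> Hom B Y Y'" and Y: "Y \<in> Obj B" "Y' \<in> Obj B" for g Y Y'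
    using arg_cong[OF dn[OF g], of "on_arr U"]
      Us(6)[OF Fs(4)[OF Us(4)[OF g]] dh[OF Y(2)]] Us(6)[OF dh[OF Y(1)] g] by simp
  have 1: "nat_trans A A ((U \<circ>\<^sub>F F) \<circ>\<^sub>F (U \<circ>\<^sub>F F)) (U \<circ>\<^sub>F F) (\<lambda>X. on_arr U (\<epsilon> (on_obj F X)))"
    unfolding nat_trans_def
    using UF is_functor_comp[OF UF UF] Us(4)[OF dh[OF Fs(3)]] dn'[OF Fs(4) Fs(3) Fs(3)]
    by simp
  have 2: "on_arr U (\<epsilon> (on_obj F X)) \<cdot>\<^bsub>A\<^esub> on_arr U (on_arr F (\<eta> X)) = Ide A (on_obj U (on_obj F X))"
    if X: "X \<in> Obj A" for X
    using Us(6)[OF Fs(4)[OF eh[OF X]] dh[OF Fs(3)[OF X]]] t1[OF X] Us(5)[OF Fs(3)[OF X]] by simp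
  show ?thesis
    unfolding is_monad_def adj_monad_def
    using UF e 1 2 t2 Fs(3) dn'[OF dh[OF Fs(3)] _ Fs(3)] Us(3) by simp
qed

lemma Mod_cat_simps [simp]:
  "Obj (Mod_cat A M) = modules A M"
  "Src (Mod_cat A M) (P, f, Q) = P"
  "Tgt (Mod_cat A M) (P, f, Q) = Q"
  "Ide (Mod_cat A M) P = (P, Ide A (fst P), P)"
  "(Q', g, R) \<cdot>\<^bsub>Mod_cat A M\<^esub> (P, f, Q) = (P, g \<cdot>\<^bsub>A\<^esub> f, R)"
  by (simp_all add: Mod_cat_def)

lemma in_Hom_Mod_cat:
  "a \<in> Hom (Mod_cat A M) P Q \<longleftrightarrow>
     P \<in> modules A M \<and> Q \<in> modules A M \<and> (\<exists>f. a = (P, f, Q) \<and> is_module_morphism A M P Q f)"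
  by (cases a) (auto simp: Hom_def Mod_cat_def)

lemma category_Mod_cat:
  assumes "is_monad A M"
  shows "category (Mod_cat A M)"
proof -
  have T: "is_functor A A (endo M)" using assms by (simp add: is_monad_def)
  note Ts = is_functorD[OF T]
  interpret category A by (rule Ts(1))
  have m: "fst P \<in> Obj A" "snd P \<in> Hom A (on_obj (endo M) (fst P)) (fst P)"
    if "P \<in> modules A M" for P using that by (auto simp: modules_def)
  show ?thesis
  proof
    fix f assume "f \<in> Arr (Mod_cat A M)"
    then show "Src (Mod_cat A M) f \<in> Obj (Mod_cat A M)" "Tgt (Mod_cat A M) f \<in> Obj (Mod_cat A M)"
      by (auto simp: Mod_cat_def)
  next
    fix P assume "P \<in> Obj (Mod_cat A M)"
    then show "Ide (Mod_cat A M) P \<in> Hom (Mod_cat A M) P P"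
      using m[of P] by (auto simp: in_Hom_Mod_cat is_module_morphism_def ide_hom Ts(5) ide_comp
          comp_ide)
  next
    fix a b P Q R assume "a \<in> Hom (Mod_cat A M) P Q" "b \<in> Hom (Mod_cat A M) Q R"
    then obtain f g where a: "a = (P, f, Q)" "b = (Q, g, R)"
      and M: "P \<in> modules A M" "Q \<in> modules A M" "R \<in> modules A M"
      and f: "f \<in> Hom A (fst P) (fst Q)" "f \<cdot>\<^bsub>A\<^esub> snd P = snd Q \<cdot>\<^bsub>A\<^esub> on_arr (endo M) f"
      and g: "g \<in> Hom A (fst Q) (fst R)" "g \<cdot>\<^bsub>A\<^esub> snd Q = snd R \<cdot>\<^bsub>A\<^esub> on_arr (endo M) g"
      by (auto simp: in_Hom_Mod_cat is_module_morphism_def)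
    have "(g \<cdot>\<^bsub>A\<^esub> f) \<cdot>\<^bsub>A\<^esub> snd P = (g \<cdot>\<^bsub>A\<^esub> snd Q) \<cdot>\<^bsub>A\<^esub> on_arr (endo M) f"
      using comp_assoc[OF m(2)[OF M(1)] f(1) g(1)]
        comp_assoc[OF Ts(4)[OF f(1)] m(2)[OF M(2)] g(1)] f(2) by simp
    also have "\<dots> = snd R \<cdot>\<^bsub>A\<^esub> on_arr (endo M) (g \<cdot>\<^bsub>A\<^esub> f)"
      using comp_assoc[OF Ts(4)[OF f(1)] Ts(4)[OF g(1)] m(2)[OF M(3)]] g(2) Ts(6)[OF f(1) g(1)]
      by simp
    finally show "b \<cdot>\<^bsub>Mod_cat A M\<^esub> a \<in> Hom (Mod_cat A M) P R"
      using M comp_hom[OF f(1) g(1)] by (simp add: a in_Hom_Mod_cat is_module_morphism_def)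
  next
    fix a P Q assume "a \<in> Hom (Mod_cat A M) P Q"
    then show "a \<cdot>\<^bsub>Mod_cat A M\<^esub> Ide (Mod_cat A M) P = a" "Ide (Mod_cat A M) Q \<cdot>\<^bsub>Mod_cat A M\<^esub> a = a"
      by (auto simp: in_Hom_Mod_cat is_module_morphism_def comp_ide ide_comp)
  next
    fix a b c P Q R S
    assume "a \<in> Hom (Mod_cat A M) P Q" "b \<in> Hom (Mod_cat A M) Q R" "c \<in> Hom (Mod_cat A M) R S"
    then show "(c \<cdot>\<^bsub>Mod_cat A M\<^esub> b) \<cdot>\<^bsub>Mod_cat A M\<^esub> a = c \<cdot>\<^bsub>Mod_cat A M\<^esub> (b \<cdot>\<^bsub>Mod_cat A M\<^esub> a)"
      by (auto simp: in_Hom_Mod_cat is_module_morphism_def comp_assoc)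
  qed
qed

lemma comparison_is_functor:
  assumes adj: "adjoint_pair A B F U \<eta> \<epsilon>"
  shows "is_functor B (Mod_cat A (adj_monad F U \<eta> \<epsilon>)) (comparison B U \<epsilon>)"
proof -
  let ?M = "adj_monad F U \<eta> \<epsilon>"
  have F: "is_functor A B F" and U: "is_functor B A U"
    and d: "nat_trans B B (F \<circ>\<^sub>F U) id_ftor \<epsilon>"
    and t2: "\<And>Y. Y \<in> Obj B \<Longrightarrow> on_arr U (\<epsilon> Y) \<cdot>\<^bsub>A\<^esub> \<eta> (on_obj U Y) = Ide A (on_obj U Y)"
    using adj by (auto simp: adjoint_pair_def)
  note Fs = is_functorD[OF F] and Us = is_functorD[OF U]
  have dh: "\<epsilon> Y \<in> Hom B (on_obj F (on_obj U Y)) Y" if "Y \<in> Obj B" for Y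
    using nat_transD(3)[OF d that] by simp
  have dn': "on_arr U (\<epsilon> Y') \<cdot>\<^bsub>A\<^esub> on_arr U (on_arr F (on_arr U g)) = on_arr U g \<cdot>\<^bsub>A\<^esub> on_arr U (\<epsilon> Y)"
    if g: "g \<in> Hom B Y Y'" and Y: "Y \<in> Obj B" "Y' \<in> Obj B" for g Y Y'
    using arg_cong[OF nat_transD(4)[OF d g], of "on_arr U"]
      Us(6)[OF Fs(4)[OF Us(4)[OF g]] dh[OF Y(2)]] Us(6)[OF dh[OF Y(1)] g] by simp
  have ob: "comparison_obj U \<epsilon> Y \<in> modules A ?M" if "Y \<in> Obj B" for Y
    using that Us(3)[OF that] Us(4)[OF dh[OF that]] t2[OF that]
      dn'[OF dh[OF that] Fs(3)[OF Us(3)[OF that]] that]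
    by (simp add: modules_def comparison_obj_def adj_monad_def)
  have mor: "is_module_morphism A ?M (comparison_obj U \<epsilon> Y) (comparison_obj U \<epsilon> Y') (on_arr U g)"
    if "g \<in> Hom B Y Y'" "Y \<in> Obj B" "Y' \<in> Obj B" for g Y Y'
    using Us(4)[OF that(1)] dn'[OF that]
    by (simp add: is_module_morphism_def comparison_obj_def adj_monad_def)
  interpret B: category B by (rule Us(1))
  have ST: "Src B g = Y" "Tgt B g = Y'" if "g \<in> Hom B Y Y'" for g Y Y'
    using that by (auto simp: Hom_def)
  show ?thesis
    unfolding is_functor_def
    using Us(1) category_Mod_cat[OF adj_monad_is_monad[OF adj]]
    by (auto simp: comparison_def in_Hom_Mod_cat ob mor ST ST[OF B.ide_hom] ST[OF B.comp_hom]
        Us(5) Us(6)) (auto simp: comparison_obj_def)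
qed

end

theory Submission
  imports Defs
begin

text \<open>
  The comparison functor \<open>K\<close> is faithful iff \<open>U\<close> is, since both have the same underlying action
  on arrows; this gives one direction. For the converse, let \<open>U\<close> be exact and faithful. A module
  \<open>(X, l)\<close> is presented by the cokernel \<open>c\<close> of \<open>F l - \<epsilon> (F X)\<close>, with target \<open>Z\<close>. As \<open>U\<close> preserves
  cokernels and \<open>l\<close> is a split coequalizer of \<open>U (F l)\<close> and \<open>U (\<epsilon> (F X))\<close>, the arrow
  \<open>U c \<cdot> \<eta> X\<close> is an isomorphism of modules from \<open>(X, l)\<close> to \<open>K Z\<close>: so \<open>K\<close> is essentially
  surjective. If \<open>(X, l) = K Y\<close>, then \<open>\<epsilon> Y\<close> factors as \<open>u \<cdot> c\<close> with \<open>U u\<close> invertible; a faithful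
  \<open>U\<close> reflects monos and epis, so \<open>u\<close> is invertible and \<open>\<epsilon> Y\<close> is itself that cokernel. Hence a
  module morphism \<open>f\<close> from \<open>K Y\<close> to \<open>K Y'\<close> lifts by factoring \<open>\<epsilon> Y' \<cdot> F f\<close> through \<open>\<epsilon> Y\<close>.
\<close>

section \<open>Categories\<close>

context category
begin

text \<open>Typing is phrased through \<open>Arr\<close>, \<open>Src\<close> and \<open>Tgt\<close>
  instead of \<open>Hom\<close>, so that the simplifier can discharge the side conditions of long
  composites.\<close>

lemma comp_arr [simp]:
  assumes "f \<in> Arr C" "g \<in> Arr C" "Src C g = Tgt C f"
  shows "g \<cdot> f \<in> Arr C" "Src C (g \<cdot> f) = Src C f" "Tgt C (g \<cdot> f) = Tgt C g"
  using comp_hom[of f "Src C f" "Tgt C f" g "Tgt C g"] assms by (auto simp: Hom_def)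

lemma ide_arr [simp]:
  assumes "X \<in> Obj C"
  shows "Ide C X \<in> Arr C" "Src C (Ide C X) = X" "Tgt C (Ide C X) = X"
  using ide_hom[OF assms] by (auto simp: Hom_def)

lemma comp_Ide [simp]: "\<lbrakk>f \<in> Arr C; Src C f = X\<rbrakk> \<Longrightarrow> f \<cdot> Ide C X = f"
  and Ide_comp [simp]: "\<lbrakk>f \<in> Arr C; Tgt C f = Y\<rbrakk> \<Longrightarrow> Ide C Y \<cdot> f = f"
  using comp_ide[of f] ide_comp[of f] by (auto simp: Hom_def)

lemma assoc:
  "\<lbrakk>f \<in> Arr C; g \<in> Arr C; h \<in> Arr C; Src C g = Tgt C f; Src C h = Tgt C g\<rbrakk>
    \<Longrightarrow> (h \<cdot> g) \<cdot> f = h \<cdot> (g \<cdot> f)"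
  using comp_assoc[of f "Src C f" "Tgt C f" g "Tgt C g" h "Tgt C h"] by (auto simp: Hom_def)

lemmas arr_obj [simp] = src_obj tgt_obj

lemma is_isoI:
  assumes "f \<in> Hom C X Y" "g \<in> Hom C Y X" "g \<cdot> f = Ide C X" "f \<cdot> g = Ide C Y"
  shows "is_iso C f"
  using assms by (auto simp: is_iso_def Hom_def)

lemma is_isoE:
  assumes "is_iso C f" "f \<in> Hom C X Y"
  obtains g where "g \<in> Hom C Y X" "g \<cdot> f = Ide C X" "f \<cdot> g = Ide C Y"
  using assms by (auto simp: is_iso_def Hom_def)

lemma epiD:
  assumes "is_epi C f" "g \<in> Arr C" "h \<in> Arr C" "Src C g = Tgt C f" "Src C h = Tgt C f"
    "Tgt C g = Tgt C h" "g \<cdot> f = h \<cdot> f"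
  shows "g = h"
proof -
  have "g \<in> Hom C (Tgt C f) (Tgt C h)" "h \<in> Hom C (Tgt C f) (Tgt C h)" "Tgt C h \<in> Obj C"
    using assms by (simp_all add: Hom_def)
  then show ?thesis using assms(1,7) unfolding is_epi_def by blast
qed

lemma monoD:
  assumes "is_mono C f" "g \<in> Arr C" "h \<in> Arr C" "Tgt C g = Src C f" "Tgt C h = Src C f"
    "Src C g = Src C h" "f \<cdot> g = f \<cdot> h"
  shows "g = h"
proof -
  have "g \<in> Hom C (Src C h) (Src C f)" "h \<in> Hom C (Src C h) (Src C f)" "Src C h \<in> Obj C"
    using assms by (simp_all add: Hom_def)
  then show ?thesis using assms(1,7) unfolding is_mono_def by blast
qed

lemma iso_mono: "is_iso C f \<Longrightarrow> is_mono C f"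
  unfolding is_mono_def is_iso_def
proof (clarsimp simp: Hom_def)
  fix h g k
  assume f: "f \<in> Arr C" "g \<in> Arr C" "Src C g = Tgt C f" "Tgt C g = Src C f"
    and gf: "g \<cdot> f = Ide C (Src C f)"
    and h: "h \<in> Arr C" "k \<in> Arr C" "Tgt C h = Src C f" "Tgt C k = Src C f"
    and e: "f \<cdot> h = f \<cdot> k"
  have "(g \<cdot> f) \<cdot> h = (g \<cdot> f) \<cdot> k"
    using f h by (simp add: e assoc)
  then show "h = k" using gf h by simp
qed

lemma iso_epi: "is_iso C f \<Longrightarrow> is_epi C f"
  unfolding is_epi_def is_iso_def
proof (clarsimp simp: Hom_def)
  fix h g k
  assume f: "f \<in> Arr C" "g \<in> Arr C" "Src C g = Tgt C f" "Tgt C g = Src C f"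
    and fg: "f \<cdot> g = Ide C (Tgt C f)"
    and h: "h \<in> Arr C" "k \<in> Arr C" "Src C h = Tgt C f" "Src C k = Tgt C f"
    and e: "h \<cdot> f = k \<cdot> f"
  have "h \<cdot> (f \<cdot> g) = k \<cdot> (f \<cdot> g)"
    using f h by (simp add: e flip: assoc)
  then show "h = k" using fg h by simp
qed

lemma is_epiI:
  assumes "f \<in> Arr C"
    and "\<And>g h. \<lbrakk>g \<in> Arr C; h \<in> Arr C; Src C g = Tgt C f; Src C h = Tgt C f;
      Tgt C g = Tgt C h; g \<cdot> f = h \<cdot> f\<rbrakk> \<Longrightarrow> g = h"
  shows "is_epi C f"
  using assms by (auto simp: is_epi_def Hom_def)

lemma is_monoI:
  assumes "f \<in> Arr C"
    and "\<And>g h. \<lbrakk>g \<in> Arr C; h \<in> Arr C; Tgt C g = Src C f; Tgt C h = Src C f;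
      Src C g = Src C h; f \<cdot> g = f \<cdot> h\<rbrakk> \<Longrightarrow> g = h"
  shows "is_mono C f"
  using assms by (auto simp: is_mono_def Hom_def)

end

section \<open>Faithful functors and equivalences\<close>

lemma functor_arr:
  assumes "is_functor C D F" "f \<in> Arr C"
  shows "on_arr F f \<in> Arr D" "Src D (on_arr F f) = on_obj F (Src C f)"
    "Tgt D (on_arr F f) = on_obj F (Tgt C f)"
  using is_functorD(4)[OF assms(1), of f "Src C f" "Tgt C f"] assms(2) by (auto simp: Hom_def)

lemma functor_comp:
  assumes "is_functor C D F" "f \<in> Arr C" "g \<in> Arr C" "Src C g = Tgt C f"
  shows "on_arr F (g \<cdot>\<^bsub>C\<^esub> f) = on_arr F g \<cdot>\<^bsub>D\<^esub> on_arr F f"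
  using is_functorD(6)[OF assms(1), of f "Src C f" "Tgt C f" g "Tgt C g"] assms(2-)
  by (auto simp: Hom_def)

lemma faithful_functorD:
  assumes "faithful_functor C D F" "f \<in> Hom C X Y" "g \<in> Hom C X Y" "on_arr F f = on_arr F g"
  shows "f = g"
proof -
  have "category C" using assms(1) by (simp add: faithful_functor_def is_functor_def)
  then have "X \<in> Obj C" "Y \<in> Obj C"
    using assms(2) category.src_obj category.tgt_obj by (fastforce simp: Hom_def)+
  then show ?thesis using assms by (auto simp: faithful_functor_def dest: inj_onD)
qed

text \<open>Apply \<open>F\<close> to an equation between composites with \<open>f\<close>, cancel
  the image of \<open>f\<close>, and remove \<open>F\<close> by faithfulness. This makes an arrow of
  \<open>B\<close> mono and epi once its image under \<open>U\<close> is invertible.\<close>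

lemma faithful_reflects_mono_epi:
  assumes F: "faithful_functor C D F" and f: "f \<in> Arr C"
  shows "is_mono D (on_arr F f) \<Longrightarrow> is_mono C f" "is_epi D (on_arr F f) \<Longrightarrow> is_epi C f"
proof -
  have F': "is_functor C D F" using F by (simp add: faithful_functor_def)
  interpret C: category C by (rule is_functorD(1)[OF F'])
  interpret D: category D by (rule is_functorD(2)[OF F'])
  note Fs = functor_arr[OF F'] functor_comp[OF F']
  show "is_mono C f" if m: "is_mono D (on_arr F f)"
  proof (rule C.is_monoI[OF f])
    fix g h assume gh: "g \<in> Arr C" "h \<in> Arr C" "Tgt C g = Src C f" "Tgt C h = Src C f"
      "Src C g = Src C h" "f \<cdot>\<^bsub>C\<^esub> g = f \<cdot>\<^bsub>C\<^esub> h"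
    have "on_arr F f \<cdot>\<^bsub>D\<^esub> on_arr F g = on_arr F f \<cdot>\<^bsub>D\<^esub> on_arr F h"
      using gh f by (simp flip: Fs(4))
    then have "on_arr F g = on_arr F h"
      using gh f by (intro D.monoD[OF m, of "on_arr F g" "on_arr F h"]) (simp_all add: Fs)
    then show "g = h"
      using faithful_functorD[OF F, of g "Src C g" "Tgt C g" h] gh by (simp add: Hom_def)
  qed
  show "is_epi C f" if m: "is_epi D (on_arr F f)"
  proof (rule C.is_epiI[OF f])
    fix g h assume gh: "g \<in> Arr C" "h \<in> Arr C" "Src C g = Tgt C f" "Src C h = Tgt C f"
      "Tgt C g = Tgt C h" "g \<cdot>\<^bsub>C\<^esub> f = h \<cdot>\<^bsub>C\<^esub> f"
    have "on_arr F g \<cdot>\<^bsub>D\<^esub> on_arr F f = on_arr F h \<cdot>\<^bsub>D\<^esub> on_arr F f"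
      using gh f by (simp flip: Fs(4))
    then have "on_arr F g = on_arr F h"
      using gh f by (intro D.epiD[OF m, of "on_arr F g" "on_arr F h"]) (simp_all add: Fs)
    then show "g = h"
      using faithful_functorD[OF F, of g "Src C g" "Tgt C g" h] gh by (simp add: Hom_def)
  qed
qed

text \<open>By naturality \<open>\<alpha> Y \<cdot> f\<close> equals
  \<open>G (F f) \<cdot> \<alpha> X\<close>, which depends on \<open>f\<close> only through
  \<open>F f\<close>; the isomorphism \<open>\<alpha> Y\<close> can then be cancelled.\<close>

lemma equivalence_functor_faithful:
  assumes "equivalence_functor C D F"
  shows "faithful_functor C D F"
proof -
  obtain G \<alpha> where F: "is_functor C D F" and \<alpha>: "nat_iso C C id_ftor (G \<circ>\<^sub>F F) \<alpha>"
    using assms by (auto simp: equivalence_functor_def)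
  have nt: "nat_trans C C id_ftor (G \<circ>\<^sub>F F) \<alpha>" using \<alpha> by (simp add: nat_iso_def)
  interpret C: category C by (rule is_functorD(1)[OF F])
  show ?thesis
    unfolding faithful_functor_def
  proof (intro conjI ballI inj_onI F)
    fix X Y f g assume XY: "X \<in> Obj C" "Y \<in> Obj C" and f: "f \<in> Hom C X Y" "g \<in> Hom C X Y"
      and e: "on_arr F f = on_arr F g"
    have "is_mono C (\<alpha> Y)" using \<alpha> XY C.iso_mono by (simp add: nat_iso_def)
    moreover have "\<alpha> Y \<cdot>\<^bsub>C\<^esub> f = \<alpha> Y \<cdot>\<^bsub>C\<^esub> g"
      using nat_transD(4)[OF nt f(1)] nat_transD(4)[OF nt f(2)] e by simp
    moreover have "Src C (\<alpha> Y) = Y" using nat_transD(3)[OF nt XY(2)] by (simp add: Hom_def)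
    ultimately show "f = g" using f by (intro C.monoD[of "\<alpha> Y" f g]) (auto simp: Hom_def)
  qed
qed

text \<open>A quasi-inverse is built by choice: essential surjectivity supplies its objects, and
  fullness and faithfulness turn conjugates of arrows of \<open>D\<close> into arrows of
  \<open>C\<close>.\<close>

lemma equivalence_functorI:
  assumes F: "faithful_functor C D F"
    and full: "\<And>X Y g. \<lbrakk>X \<in> Obj C; Y \<in> Obj C; g \<in> Hom D (on_obj F X) (on_obj F Y)\<rbrakk>
      \<Longrightarrow> \<exists>f\<in>Hom C X Y. on_arr F f = g"
    and ess: "\<And>Z. Z \<in> Obj D \<Longrightarrow> \<exists>X\<in>Obj C. \<exists>e\<in>Hom D (on_obj F X) Z. is_iso D e"
  shows "equivalence_functor C D F"
proof -
  have F': "is_functor C D F" using F by (simp add: faithful_functor_def)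
  interpret C: category C by (rule is_functorD(1)[OF F'])
  interpret D: category D by (rule is_functorD(2)[OF F'])
  note Fs [simp] = functor_arr[OF F'] functor_comp[OF F'] is_functorD(3,5)[OF F']
  \<comment> \<open>Each isomorphism \<open>b\<close> is chosen together with an inverse
    \<open>b'\<close>, so that both can be used equationally.\<close>
  have "\<exists>X b b'. X \<in> Obj C \<and> b \<in> Hom D (on_obj F X) Z \<and> b' \<in> Hom D Z (on_obj F X)
      \<and> b' \<cdot>\<^bsub>D\<^esub> b = Ide D (on_obj F X) \<and> b \<cdot>\<^bsub>D\<^esub> b' = Ide D Z" if "Z \<in> Obj D" for Z
    using ess[OF that] by (blast elim: D.is_isoE)
  then obtain Go b b' where G: "\<And>Z. Z \<in> Obj D \<Longrightarrow> Go Z \<in> Obj C \<and> b Z \<in> Hom D (on_obj F (Go Z)) Z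
      \<and> b' Z \<in> Hom D Z (on_obj F (Go Z))
      \<and> b' Z \<cdot>\<^bsub>D\<^esub> b Z = Ide D (on_obj F (Go Z)) \<and> b Z \<cdot>\<^bsub>D\<^esub> b' Z = Ide D Z"
    by metis
  have [simp]: "Go Z \<in> Obj C" "b Z \<in> Arr D" "Src D (b Z) = on_obj F (Go Z)" "Tgt D (b Z) = Z"
      "b' Z \<in> Arr D" "Tgt D (b' Z) = on_obj F (Go Z)" "Src D (b' Z) = Z"
      "b' Z \<cdot>\<^bsub>D\<^esub> b Z = Ide D (on_obj F (Go Z))" "b Z \<cdot>\<^bsub>D\<^esub> b' Z = Ide D Z"
    if "Z \<in> Obj D" for Z
    using G[OF that] by (auto simp: Hom_def)
  \<comment> \<open>These two rules cancel the inverse pair inside composites nested to the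
    right.\<close>
  have [simp]: "b' Z \<cdot>\<^bsub>D\<^esub> (b Z \<cdot>\<^bsub>D\<^esub> h) = h" if "Z \<in> Obj D" "h \<in> Arr D" "Tgt D h = on_obj F (Go Z)" for h Z
    using that by (simp flip: D.assoc)
  have [simp]: "b Z \<cdot>\<^bsub>D\<^esub> (b' Z \<cdot>\<^bsub>D\<^esub> h) = h" if "Z \<in> Obj D" "h \<in> Arr D" "Tgt D h = Z" for h Z
    using that by (simp flip: D.assoc)
  \<comment> \<open>\<open>P X Y g\<close> is the preimage of \<open>g\<close> under
    \<open>F\<close>: fullness gives its existence, faithfulness its uniqueness.\<close>
  define P where "P X Y g = (SOME f. f \<in> Hom C X Y \<and> on_arr F f = g)" for X Y g
  have P: "P X Y g \<in> Hom C X Y" "on_arr F (P X Y g) = g"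
    if "X \<in> Obj C" "Y \<in> Obj C" "g \<in> Hom D (on_obj F X) (on_obj F Y)" for X Y g
    using someI_ex[of "\<lambda>f. f \<in> Hom C X Y \<and> on_arr F f = g"] full[OF that] by (auto simp: P_def)
  have [simp]: "P X Y g \<in> Arr C" "Src C (P X Y g) = X" "Tgt C (P X Y g) = Y" "on_arr F (P X Y g) = g"
    if "X \<in> Obj C" "Y \<in> Obj C" "g \<in> Arr D" "Src D g = on_obj F X" "Tgt D g = on_obj F Y" for X Y g
    using P[of X Y g] that by (auto simp: Hom_def)
  \<comment> \<open>Equations in \<open>C\<close> are checked after applying \<open>F\<close>; the
    functor laws of \<open>G\<close> and the naturality of \<open>\<alpha>\<close> thereby reduce to
    cancelling \<open>b\<close> against \<open>b'\<close>.\<close>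
  have eq: "f = g" if "f \<in> Arr C" "g \<in> Arr C" "Src C f = Src C g" "Tgt C f = Tgt C g"
    "on_arr F f = on_arr F g" for f g
    using faithful_functorD[OF F, of f "Src C f" "Tgt C f" g] that by (simp add: Hom_def)
  \<comment> \<open>An arrow \<open>h\<close> is conjugated by the chosen isomorphisms and then
    lifted along \<open>F\<close>.\<close>
  define G where "G = \<lparr>on_obj = Go, on_arr = (\<lambda>h. P (Go (Src D h)) (Go (Tgt D h))
      (b' (Tgt D h) \<cdot>\<^bsub>D\<^esub> (h \<cdot>\<^bsub>D\<^esub> b (Src D h))))\<rparr>"
  have [simp]: "on_obj G Z = Go Z" for Z by (simp add: G_def)
  have [simp]: "on_arr G h \<in> Arr C" "Src C (on_arr G h) = Go (Src D h)"
    "Tgt C (on_arr G h) = Go (Tgt D h)"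
    "on_arr F (on_arr G h) = b' (Tgt D h) \<cdot>\<^bsub>D\<^esub> (h \<cdot>\<^bsub>D\<^esub> b (Src D h))" if "h \<in> Arr D" for h
    using that by (simp_all add: G_def)
  have G: "is_functor D C G"
    unfolding is_functor_def
    by (auto simp: C.category_axioms D.category_axioms Hom_def D.assoc intro!: eq)
  \<comment> \<open>The unit at \<open>X\<close> lifts \<open>b'\<close> at \<open>F X\<close>; its
    inverse will be the lift of \<open>b\<close> at \<open>F X\<close>. The counit is
    \<open>b\<close> itself.\<close>
  define \<alpha> where "\<alpha> X = P X (Go (on_obj F X)) (b' (on_obj F X))" for X
  have [simp]: "\<alpha> X \<in> Arr C" "Src C (\<alpha> X) = X" "Tgt C (\<alpha> X) = Go (on_obj F X)"
    "on_arr F (\<alpha> X) = b' (on_obj F X)" if "X \<in> Obj C" for X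
    using that by (simp_all add: \<alpha>_def)
  have [simp]: "is_functor C C id_ftor"
    by (simp add: is_functor_def C.category_axioms)
  have [simp]: "is_functor D D id_ftor"
    by (simp add: is_functor_def D.category_axioms)
  have "nat_trans C C id_ftor (G \<circ>\<^sub>F F) \<alpha>"
    unfolding nat_trans_def
    by (auto simp: is_functor_comp[OF F' G] Hom_def D.assoc intro!: eq)
  moreover have "is_iso C (\<alpha> X)" if X: "X \<in> Obj C" for X
    by (rule C.is_isoI[of _ X "Go (on_obj F X)" "P (Go (on_obj F X)) X (b (on_obj F X))"])
      (use X in \<open>auto simp: Hom_def intro!: eq\<close>)
  moreover have "nat_trans D D (F \<circ>\<^sub>F G) id_ftor b"
    unfolding nat_trans_def
    by (auto simp: is_functor_comp[OF G F'] Hom_def)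
  moreover have "is_iso D (b Z)" if Z: "Z \<in> Obj D" for Z
    by (rule D.is_isoI[of _ "on_obj F (Go Z)" Z "b' Z"]) (use Z in \<open>auto simp: Hom_def\<close>)
  ultimately show ?thesis
    unfolding equivalence_functor_def nat_iso_def using F' G by blast
qed


section \<open>Abelian categories\<close>

context preadditive_category
begin

lemma zero_arr [simp]:
  assumes "X \<in> Obj C" "Y \<in> Obj C"
  shows "Zero C X Y \<in> Arr C" "Src C (Zero C X Y) = X" "Tgt C (Zero C X Y) = Y"
proof -
  interpret comm_group "HomGroup C X Y" using hom_group assms .
  show "Zero C X Y \<in> Arr C" "Src C (Zero C X Y) = X" "Tgt C (Zero C X Y) = Y"
    using one_closed by (auto simp: HomGroup_def Hom_def)
qed

lemma zero_hom: "\<lbrakk>X \<in> Obj C; Y \<in> Obj C\<rbrakk> \<Longrightarrow> Zero C X Y \<in> Hom C X Y"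
  by (simp add: Hom_def)

text \<open>The group laws of the hom-sets, extracted from \<open>HomGroup\<close>. The difference
  of \<open>f\<close> and \<open>g\<close> is represented by an arrow \<open>d\<close> with
  \<open>d \<boxplus> g = f\<close>.\<close>

lemma zero_plus: "f \<in> Hom C X Y \<Longrightarrow> Zero C X Y \<boxplus> f = f"
  and plus_cancel: "\<lbrakk>f \<in> Hom C X Y; g \<in> Hom C X Y; h \<in> Hom C X Y; f \<boxplus> h = g \<boxplus> h\<rbrakk> \<Longrightarrow> f = g"
  and ex_diff: "\<lbrakk>f \<in> Hom C X Y; g \<in> Hom C X Y\<rbrakk> \<Longrightarrow> \<exists>d\<in>Hom C X Y. d \<boxplus> g = f"
proof -
  have *: "comm_group (HomGroup C X Y)" if "f \<in> Hom C X Y" for f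
    using that by (intro hom_group) (auto simp: Hom_def)
  show "f \<in> Hom C X Y \<Longrightarrow> Zero C X Y \<boxplus> f = f"
    using group.is_monoid[OF comm_group.axioms(2)[OF *], THEN monoid.l_one]
    by (force simp: HomGroup_def)
  show "f = g" if fg: "f \<in> Hom C X Y" "g \<in> Hom C X Y" "h \<in> Hom C X Y" "f \<boxplus> h = g \<boxplus> h"
  proof -
    interpret comm_group "HomGroup C X Y" by (rule *[OF fg(1)])
    show ?thesis using right_cancel[of h f g] fg by (simp add: HomGroup_def)
  qed
  show "\<exists>d\<in>Hom C X Y. d \<boxplus> g = f" if fg: "f \<in> Hom C X Y" "g \<in> Hom C X Y"
  proof -
    interpret comm_group "HomGroup C X Y" by (rule *[OF fg(1)])
    let ?d = "f \<otimes>\<^bsub>HomGroup C X Y\<^esub> inv\<^bsub>HomGroup C X Y\<^esub> g"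
    have g: "f \<in> carrier (HomGroup C X Y)" "g \<in> carrier (HomGroup C X Y)"
      using fg by (simp_all add: HomGroup_def)
    have "?d \<otimes>\<^bsub>HomGroup C X Y\<^esub> g = f" "?d \<in> carrier (HomGroup C X Y)"
      using g by (simp_all add: m_assoc)
    then show ?thesis by (auto simp: HomGroup_def)
  qed
qed

text \<open>Identifies composites with zero arrows, and images of zero arrows under additive
  functors: distributing over \<open>0 + 0 = 0\<close> produces an arrow equal to its own
  double.\<close>

lemma plus_self_zero: "\<lbrakk>f \<in> Hom C X Y; f \<boxplus> f = f\<rbrakk> \<Longrightarrow> f = Zero C X Y"
  using plus_cancel[of f X Y "Zero C X Y" f] zero_plus[of f X Y] zero_hom[of X Y]
  by (auto simp: Hom_def)

lemma comp_zero [simp]: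
  assumes "f \<in> Arr C" "Src C f = Y" "X \<in> Obj C"
  shows "f \<cdot> Zero C X Y = Zero C X (Tgt C f)"
proof (rule plus_self_zero)
  have Y: "Y \<in> Obj C" using assms by auto
  have f: "f \<in> Hom C Y (Tgt C f)" using assms by (simp add: Hom_def)
  note z = zero_hom[OF assms(3) Y]
  show "f \<cdot> Zero C X Y \<in> Hom C X (Tgt C f)" using comp_hom[OF z f] .
  show "f \<cdot> Zero C X Y \<boxplus> f \<cdot> Zero C X Y = f \<cdot> Zero C X Y"
    using comp_plus[OF z z f] zero_plus[OF z] by simp
qed

lemma zero_comp [simp]:
  assumes "f \<in> Arr C" "Tgt C f = Y" "Z \<in> Obj C"
  shows "Zero C Y Z \<cdot> f = Zero C (Src C f) Z"
proof (rule plus_self_zero)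
  have Y: "Y \<in> Obj C" using assms by auto
  have f: "f \<in> Hom C (Src C f) Y" using assms by (simp add: Hom_def)
  note z = zero_hom[OF Y assms(3)]
  show "Zero C Y Z \<cdot> f \<in> Hom C (Src C f) Z" using comp_hom[OF f z] .
  show "Zero C Y Z \<cdot> f \<boxplus> Zero C Y Z \<cdot> f = Zero C Y Z \<cdot> f"
    using plus_comp[OF f z z] zero_plus[OF z] by simp
qed

text \<open>The bridge from cokernels to coequalizers: killing a difference means coequalizing the
  two arrows.\<close>

lemma comp_diff_zero_iff:
  assumes "d \<in> Hom C X Y" "f \<in> Hom C X Y" "g \<in> Hom C X Y" "d \<boxplus> g = f" "h \<in> Hom C Y Z"
  shows "h \<cdot> d = Zero C X Z \<longleftrightarrow> h \<cdot> f = h \<cdot> g"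
proof -
  have e: "(h \<cdot> d) \<boxplus> (h \<cdot> g) = h \<cdot> f" using comp_plus[OF assms(1,3,5)] assms(4) by simp
  have H: "h \<cdot> d \<in> Hom C X Z" "h \<cdot> g \<in> Hom C X Z" using assms comp_hom by blast+
  have z: "Zero C X Z \<in> Hom C X Z" using H by (intro zero_hom) (auto simp: Hom_def)
  show ?thesis
    using e zero_plus[OF H(2)] plus_cancel[OF H(1) z H(2)] by auto
qed

lemma diff_comp_zero_iff:
  assumes "d \<in> Hom C X Y" "f \<in> Hom C X Y" "g \<in> Hom C X Y" "d \<boxplus> g = f" "h \<in> Hom C W X"
  shows "d \<cdot> h = Zero C W Y \<longleftrightarrow> f \<cdot> h = g \<cdot> h"
proof -
  have e: "(d \<cdot> h) \<boxplus> (g \<cdot> h) = f \<cdot> h" using plus_comp[OF assms(5,1,3)] assms(4) by simp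
  have H: "d \<cdot> h \<in> Hom C W Y" "g \<cdot> h \<in> Hom C W Y" using assms comp_hom by blast+
  have z: "Zero C W Y \<in> Hom C W Y" using H by (intro zero_hom) (auto simp: Hom_def)
  show ?thesis
    using e zero_plus[OF H(2)] plus_cancel[OF H(1) z H(2)] by auto
qed

text \<open>Two arrows agreeing after \<open>f\<close> have a difference that kills
  \<open>f\<close>, so testing against zero is enough.\<close>

lemma is_epiI_zero:
  assumes f: "f \<in> Arr C"
    and z: "\<And>h. \<lbrakk>h \<in> Arr C; Src C h = Tgt C f; h \<cdot> f = Zero C (Src C f) (Tgt C h)\<rbrakk>
      \<Longrightarrow> h = Zero C (Src C h) (Tgt C h)"
  shows "is_epi C f"
proof (rule is_epiI[OF f])
  fix g h assume gh: "g \<in> Arr C" "h \<in> Arr C" "Src C g = Tgt C f" "Src C h = Tgt C f"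
      "Tgt C g = Tgt C h" "g \<cdot> f = h \<cdot> f"
  let ?Y = "Tgt C f" and ?Z = "Tgt C h"
  have H: "g \<in> Hom C ?Y ?Z" "h \<in> Hom C ?Y ?Z" "f \<in> Hom C (Src C f) ?Y"
    using f gh by (simp_all add: Hom_def)
  obtain d where d: "d \<in> Hom C ?Y ?Z" "d \<boxplus> h = g" using ex_diff[OF H(1,2)] by blast
  have "d \<cdot> f = Zero C (Src C f) ?Z"
    using diff_comp_zero_iff[OF d(1) H(1,2) d(2) H(3)] gh by simp
  then have "d = Zero C ?Y ?Z" using z[of d] d(1) by (simp add: Hom_def)
  then show "g = h" using zero_plus[OF H(2)] d(2) by simp
qed

lemma cokernelD:
  assumes "is_cokernel C c f"
  shows "f \<in> Arr C" "c \<in> Arr C" "Src C c = Tgt C f" "c \<cdot> f = Zero C (Src C f) (Tgt C c)"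
  using assms by (simp_all add: is_cokernel_def)

lemma kernelD:
  assumes "is_kernel C k f"
  shows "f \<in> Arr C" "k \<in> Arr C" "Tgt C k = Src C f" "f \<cdot> k = Zero C (Src C k) (Tgt C f)"
  using assms by (simp_all add: is_kernel_def)

lemma cokernel_factor:
  assumes "is_cokernel C c f" "h \<in> Arr C" "Src C h = Tgt C f" "h \<cdot> f = Zero C (Src C f) (Tgt C h)"
  obtains u where "u \<in> Arr C" "Src C u = Tgt C c" "Tgt C u = Tgt C h" "u \<cdot> c = h"
proof -
  have "h \<in> Hom C (Tgt C f) (Tgt C h)" "Tgt C h \<in> Obj C" using assms by (simp_all add: Hom_def)
  then have "\<exists>u. u \<in> Hom C (Tgt C c) (Tgt C h) \<and> u \<cdot> c = h"
    using assms unfolding is_cokernel_def by blast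
  then show ?thesis using that by (auto simp: Hom_def)
qed

lemma kernel_factor:
  assumes "is_kernel C k f" "h \<in> Arr C" "Tgt C h = Src C f" "f \<cdot> h = Zero C (Src C h) (Tgt C f)"
  obtains u where "u \<in> Arr C" "Src C u = Src C h" "Tgt C u = Src C k" "k \<cdot> u = h"
proof -
  have "h \<in> Hom C (Src C h) (Src C f)" "Src C h \<in> Obj C" using assms by (simp_all add: Hom_def)
  then have "\<exists>u. u \<in> Hom C (Src C h) (Src C k) \<and> k \<cdot> u = h"
    using assms unfolding is_kernel_def by blast
  then show ?thesis using that by (auto simp: Hom_def)
qed

text \<open>Arrows \<open>g\<close> and \<open>h\<close> with
  \<open>g \<cdot> c = h \<cdot> c\<close> are two factorizations of the same arrow, which kills
  \<open>f\<close>; factorizations are unique.\<close>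

lemma cokernel_epi:
  assumes c: "is_cokernel C c f"
  shows "is_epi C c"
proof (rule is_epiI)
  note cs = cokernelD[OF c]
  show "c \<in> Arr C" by (rule cs)
  fix g h assume gh: "g \<in> Arr C" "h \<in> Arr C" "Src C g = Tgt C c" "Src C h = Tgt C c"
      "Tgt C g = Tgt C h" "g \<cdot> c = h \<cdot> c"
  have "(h \<cdot> c) \<cdot> f = Zero C (Src C f) (Tgt C h)" using cs gh by (simp add: assoc)
  then have "\<exists>!u. u \<in> Hom C (Tgt C c) (Tgt C h) \<and> u \<cdot> c = h \<cdot> c"
    using c gh cs unfolding is_cokernel_def by (simp add: Hom_def)
  then show "g = h" using gh by (auto simp: Hom_def)
qed

lemma kernel_mono:
  assumes k: "is_kernel C k f"
  shows "is_mono C k"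
proof (rule is_monoI)
  note ks = kernelD[OF k]
  show "k \<in> Arr C" by (rule ks)
  fix g h assume gh: "g \<in> Arr C" "h \<in> Arr C" "Tgt C g = Src C k" "Tgt C h = Src C k"
      "Src C g = Src C h" "k \<cdot> g = k \<cdot> h"
  have "f \<cdot> (k \<cdot> h) = Zero C (Src C h) (Tgt C f)" using ks gh by (simp flip: assoc)
  then have "\<exists>!u. u \<in> Hom C (Src C h) (Src C k) \<and> k \<cdot> u = k \<cdot> h"
    using k gh ks unfolding is_kernel_def by (simp add: Hom_def)
  then show "g = h" using gh by (auto simp: Hom_def)
qed

text \<open>Uniqueness of factorizations is supplied by \<open>c\<close> being epi, so only their
  existence is left to show.\<close>

lemma is_cokernelI:
  assumes "f \<in> Arr C" "is_epi C c" "Src C c = Tgt C f" "c \<cdot> f = Zero C (Src C f) (Tgt C c)"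
    and fac: "\<And>h. \<lbrakk>h \<in> Arr C; Src C h = Tgt C f; h \<cdot> f = Zero C (Src C f) (Tgt C h)\<rbrakk>
      \<Longrightarrow> \<exists>u. u \<in> Arr C \<and> Src C u = Tgt C c \<and> Tgt C u = Tgt C h \<and> u \<cdot> c = h"
  shows "is_cokernel C c f"
  unfolding is_cokernel_def
proof (intro conjI ballI impI)
  show "c \<in> Arr C" using assms by (simp add: is_epi_def)
  fix W h assume h: "W \<in> Obj C" "h \<in> Hom C (Tgt C f) W" "h \<cdot> f = Zero C (Src C f) W"
  then obtain u where "u \<in> Arr C" "Src C u = Tgt C c" "Tgt C u = Tgt C h" "u \<cdot> c = h"
    using fac[of h] by (auto simp: Hom_def)
  then show "\<exists>!u. u \<in> Hom C (Tgt C c) W \<and> u \<cdot> c = h"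
    using h by (intro ex1I[of _ u]) (auto simp: Hom_def intro: epiD[OF assms(2)])
qed (use assms in auto)

text \<open>\<open>f\<close> factors through \<open>k\<close>, so an arrow killing \<open>k\<close>
  kills \<open>f\<close> and hence factors through \<open>c\<close>.\<close>

lemma cokernel_of_kernel:
  assumes c: "is_cokernel C c f" and k: "is_kernel C k c"
  shows "is_cokernel C c k"
proof (rule is_cokernelI)
  note cs = cokernelD[OF c] and ks = kernelD[OF k]
  show "k \<in> Arr C" "Src C c = Tgt C k" "c \<cdot> k = Zero C (Src C k) (Tgt C c)" using ks by simp_all
  show "is_epi C c" by (rule cokernel_epi[OF c])
  obtain e where e: "e \<in> Arr C" "Src C e = Src C f" "Tgt C e = Src C k" "k \<cdot> e = f"
    using kernel_factor[OF k, of f] cs by metis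
  fix h assume h: "h \<in> Arr C" "Src C h = Tgt C k" "h \<cdot> k = Zero C (Src C k) (Tgt C h)"
  have "(h \<cdot> k) \<cdot> e = Zero C (Src C f) (Tgt C h)" using e h ks by simp
  moreover have "(h \<cdot> k) \<cdot> e = h \<cdot> f"
    using e h(1,2) ks by (simp add: assoc)
  ultimately have "h \<cdot> f = Zero C (Src C f) (Tgt C h)" by simp
  then show "\<exists>u. u \<in> Arr C \<and> Src C u = Tgt C c \<and> Tgt C u = Tgt C h \<and> u \<cdot> c = h"
    using cokernel_factor[OF c, of h] h cs ks by metis
qed

end

section \<open>Balancedness, images and short exact sequences\<close>

context abelian_category
begin

text \<open>The epi \<open>f\<close> is a cokernel of some \<open>g\<close>. As \<open>f\<close> is
  mono and \<open>f \<cdot> g\<close> is zero, \<open>g\<close> is zero, so the identity factors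
  through \<open>f\<close>; this left inverse is two-sided because \<open>f\<close> is epi.\<close>

lemma mono_epi_iso:
  assumes m: "is_mono C f" and e: "is_epi C f"
  shows "is_iso C f"
proof -
  obtain g where g: "is_cokernel C f g" using epi_normal[OF e] by blast
  note gs = cokernelD[OF g]
  have "g = Zero C (Src C g) (Src C f)"
    by (rule monoD[OF m]) (use gs in simp_all)
  then have "Ide C (Src C f) \<cdot> g = Zero C (Src C g) (Src C f)" using gs by simp
  then obtain u where u: "u \<in> Arr C" "Src C u = Tgt C f" "Tgt C u = Src C f" "u \<cdot> f = Ide C (Src C f)"
    using cokernel_factor[OF g, of "Ide C (Src C f)"] gs by auto
  have "f \<cdot> u = Ide C (Tgt C f)"
    by (rule epiD[OF e]) (use u gs in \<open>simp_all add: assoc\<close>)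
  then show ?thesis
    by (intro is_isoI[of f "Src C f" "Tgt C f" u]) (use u gs in \<open>simp_all add: Hom_def\<close>)
qed

text \<open>The kernel \<open>i\<close> yields \<open>e\<close>. For \<open>e\<close> to be epi, let
  \<open>h\<close> kill \<open>e\<close> and let \<open>k\<close> be the kernel of \<open>h\<close>.
  Then \<open>f\<close> factors through the mono \<open>i \<cdot> k\<close>, which is itself a
  kernel; comparing it with \<open>i\<close> gives \<open>k\<close> a right inverse, so
  \<open>h\<close> is zero.\<close>

lemma image_factorization:
  assumes c: "is_cokernel C c f" and i: "is_kernel C i c"
  obtains e where "is_epi C e" "Src C e = Src C f" "Tgt C e = Src C i" "i \<cdot> e = f"
proof -
  note cs = cokernelD[OF c] and ks = kernelD[OF i]
  obtain e where e: "e \<in> Arr C" "Src C e = Src C f" "Tgt C e = Src C i" "i \<cdot> e = f"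
    using kernel_factor[OF i, of f] cs by metis
  have "is_epi C e"
  proof (rule is_epiI_zero[OF e(1)])
    fix h assume h: "h \<in> Arr C" "Src C h = Tgt C e" "h \<cdot> e = Zero C (Src C e) (Tgt C h)"
    obtain k where k: "is_kernel C k h" using kernels[OF h(1)] by blast
    note kk = kernelD[OF k]
    obtain e' where e': "e' \<in> Arr C" "Src C e' = Src C e" "Tgt C e' = Src C k" "k \<cdot> e' = e"
      using kernel_factor[OF k e(1)] h by metis
    have "is_mono C (i \<cdot> k)"
    proof (rule is_monoI)
      show "i \<cdot> k \<in> Arr C" using kk ks e h by simp
      fix p q assume pq: "p \<in> Arr C" "q \<in> Arr C" "Tgt C p = Src C (i \<cdot> k)" "Tgt C q = Src C (i \<cdot> k)"
        "Src C p = Src C q" "(i \<cdot> k) \<cdot> p = (i \<cdot> k) \<cdot> q"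
      have kpq: "k \<cdot> p = k \<cdot> q"
        by (rule monoD[OF kernel_mono[OF i]]) (use pq kk ks e h in \<open>simp_all add: assoc\<close>)
      show "p = q"
        by (rule monoD[OF kernel_mono[OF k]]) (use pq kpq kk ks e h in simp_all)
    qed
    then obtain g where g: "is_kernel C (i \<cdot> k) g" using mono_normal by blast
    note gs = kernelD[OF g]
    have gi: "Src C g = Tgt C i" using gs kk ks e h by simp
    have "(g \<cdot> (i \<cdot> k)) \<cdot> e' = Zero C (Src C f) (Tgt C g)"
      using gs e' e kk ks h by simp
    then have "g \<cdot> f = Zero C (Src C f) (Tgt C g)"
      using gs(1) gi e' e kk(1,2,3) ks(1,2,3) h(1,2) by (simp add: assoc)
    \<comment> \<open>Since \<open>g\<close> kills \<open>f\<close>, it factors through the cokernel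
      \<open>c\<close>; as \<open>c\<close> kills \<open>i\<close>, so does
      \<open>g\<close>.\<close>
    then obtain w where w: "w \<in> Arr C" "Src C w = Tgt C c" "Tgt C w = Tgt C g" "w \<cdot> c = g"
      using cokernel_factor[OF c gs(1)] gi ks cs by metis
    have "g \<cdot> i = w \<cdot> (c \<cdot> i)" using assoc[of i c w] w ks(1-3) by simp
    then have "g \<cdot> i = Zero C (Src C i) (Tgt C g)" using w ks by simp
    \<comment> \<open>Hence \<open>i\<close> factors through \<open>i \<cdot> k\<close>, the kernel
      of \<open>g\<close>; cancelling the mono \<open>i\<close> makes \<open>s\<close> a right
      inverse of \<open>k\<close>.\<close>
    then obtain s where s: "s \<in> Arr C" "Src C s = Src C i" "Tgt C s = Src C (i \<cdot> k)"
      "(i \<cdot> k) \<cdot> s = i"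
      using kernel_factor[OF g ks(2)] gi by metis
    have sk: "Tgt C s = Src C k" using s kk ks e h by simp
    have "k \<cdot> s = Ide C (Src C i)"
      by (rule monoD[OF kernel_mono[OF i]]) (use s sk kk ks e h in \<open>simp_all flip: assoc\<close>)
    then have "h = (h \<cdot> k) \<cdot> s"
      using h e kk(2,3) s(1) sk by (simp add: assoc)
    also have "\<dots> = Zero C (Src C h) (Tgt C h)"
      using kk s sk h e by simp
    finally show "h = Zero C (Src C h) (Tgt C h)" .
  qed
  then show ?thesis using that e by blast
qed

text \<open>The arrow \<open>i\<close> is its own image, because \<open>c\<close> is also a cokernel
  of \<open>i\<close>.\<close>

lemma short_exact_kernel:
  assumes "is_cokernel C c f" "is_kernel C i c"
  shows "short_exact C i c"
  unfolding short_exact_def exact_pair_def is_image_def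
  using assms kernel_mono cokernel_epi cokernel_of_kernel by blast

end

section \<open>Additive and exact functors\<close>

lemma additive_functor_plus:
  assumes "additive_functor C D F" "f \<in> Hom C X Y" "g \<in> Hom C X Y"
  shows "on_arr F (f \<boxplus>\<^bsub>C\<^esub> g) = on_arr F f \<boxplus>\<^bsub>D\<^esub> on_arr F g"
proof -
  interpret category C using assms(1) by (simp add: additive_functor_def is_functor_def)
  have "X \<in> Obj C" "Y \<in> Obj C" using assms(2) by (auto simp: Hom_def)
  then have "on_arr F \<in> hom (HomGroup C X Y) (HomGroup D (on_obj F X) (on_obj F Y))"
    using assms(1) by (simp add: additive_functor_def)
  from hom_mult[OF this] show ?thesis using assms(2,3) by (simp add: HomGroup_def)
qed

lemma additive_functor_zero:
  assumes F: "additive_functor C D F" and C: "preadditive_category C" and D: "preadditive_category D"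
    and X: "X \<in> Obj C" "Y \<in> Obj C"
  shows "on_arr F (Zero C X Y) = Zero D (on_obj F X) (on_obj F Y)"
proof (rule preadditive_category.plus_self_zero[OF D])
  note z = preadditive_category.zero_hom[OF C X]
  show "on_arr F (Zero C X Y) \<in> Hom D (on_obj F X) (on_obj F Y)"
    using F z by (auto simp: additive_functor_def dest: is_functorD(4))
  show "on_arr F (Zero C X Y) \<boxplus>\<^bsub>D\<^esub> on_arr F (Zero C X Y) = on_arr F (Zero C X Y)"
    using additive_functor_plus[OF F z z] preadditive_category.zero_plus[OF C z] by simp
qed

text \<open>An epi is a cokernel, so together with its kernel it forms a short exact sequence, which
  \<open>F\<close> preserves.\<close>

lemma exact_functor_epi:
  assumes "abelian_category C" "exact_functor C D F" "is_epi C f"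
  shows "is_epi D (on_arr F f)"
proof -
  interpret abelian_category C by fact
  obtain g where g: "is_cokernel C f g" using epi_normal[OF assms(3)] by blast
  obtain k where "is_kernel C k f" using kernels cokernelD(2)[OF g] by blast
  then have "short_exact C k f" using g short_exact_kernel by blast
  then show ?thesis using assms(2) by (auto simp: exact_functor_def short_exact_def)
qed

text \<open>Exactness speaks of short exact sequences only, so \<open>f\<close> is split into an epi
  \<open>e\<close> followed by the kernel \<open>i\<close> of \<open>c\<close>. An arrow killing
  \<open>F f\<close> kills \<open>F i\<close>, since \<open>F e\<close> is epi, and then exactness
  at \<open>F i\<close>, \<open>F c\<close> lets it factor.\<close>

lemma exact_functor_cokernel:
  assumes C: "abelian_category C" and D: "abelian_category D" and F: "exact_functor C D F"
    and c: "is_cokernel C c f"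
  shows "is_cokernel D (on_arr F c) (on_arr F f)"
proof -
  interpret C: abelian_category C by fact
  interpret D: abelian_category D by fact
  have add: "additive_functor C D F" using F by (simp add: exact_functor_def)
  then have F': "is_functor C D F" by (simp add: additive_functor_def)
  note Fs = functor_arr[OF F'] functor_comp[OF F']
    additive_functor_zero[OF add C.preadditive_category_axioms D.preadditive_category_axioms]
  note cs = C.cokernelD[OF c]
  obtain i where i: "is_kernel C i c" using C.kernels cs by blast
  note ist = C.kernelD[OF i]
  obtain e where e: "is_epi C e" "Src C e = Src C f" "Tgt C e = Src C i" "i \<cdot>\<^bsub>C\<^esub> e = f"
    using C.image_factorization[OF c i] .
  have ea: "e \<in> Arr C" using e by (simp add: is_epi_def)
  have "short_exact D (on_arr F i) (on_arr F c)"
    using C.short_exact_kernel[OF c i] F by (auto simp: exact_functor_def)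
  \<comment> \<open>Exactness unfolded: \<open>j\<close> is at once the image of \<open>F i\<close>
    and a kernel of \<open>F c\<close>.\<close>
  then obtain j q where q: "is_cokernel D q (on_arr F i)" "is_kernel D j q"
    and j: "is_kernel D j (on_arr F c)" and Fc: "is_epi D (on_arr F c)"
    by (auto simp: short_exact_def exact_pair_def is_image_def)
  obtain g where "is_cokernel D (on_arr F c) g" using D.epi_normal[OF Fc] by blast
  then have Fcj: "is_cokernel D (on_arr F c) j" using D.cokernel_of_kernel j by blast
  note qs = D.cokernelD[OF q(1)] and js = D.kernelD[OF j] D.kernelD[OF q(2)]
  show ?thesis
  proof (rule D.is_cokernelI[OF _ Fc])
    show "on_arr F f \<in> Arr D" "Src D (on_arr F c) = Tgt D (on_arr F f)"
      using cs by (simp_all add: Fs)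
    show "on_arr F c \<cdot>\<^bsub>D\<^esub> on_arr F f = Zero D (Src D (on_arr F f)) (Tgt D (on_arr F c))"
      using cs by (simp add: Fs flip: Fs(4))
    fix h assume h: "h \<in> Arr D" "Src D h = Tgt D (on_arr F f)"
      "h \<cdot>\<^bsub>D\<^esub> on_arr F f = Zero D (Src D (on_arr F f)) (Tgt D h)"
    have Ff: "on_arr F f = on_arr F i \<cdot>\<^bsub>D\<^esub> on_arr F e"
      using e ea ist by (simp flip: Fs(4))
    have "h \<cdot>\<^bsub>D\<^esub> on_arr F i = Zero D (on_obj F (Src C i)) (Tgt D h)"
      by (rule D.epiD[OF exact_functor_epi[OF C F e(1)]])
        (use h e ea ist cs Ff in \<open>simp_all add: Fs is_functorD(3)[OF F'] D.assoc\<close>)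
    \<comment> \<open>Factoring \<open>h\<close> through \<open>q\<close> shows that
      \<open>h\<close> kills \<open>j\<close>, and \<open>F c\<close> is a cokernel of
      \<open>j\<close>.\<close>
    then obtain v where v: "v \<in> Arr D" "Src D v = Tgt D q" "Tgt D v = Tgt D h" "v \<cdot>\<^bsub>D\<^esub> q = h"
      using D.cokernel_factor[OF q(1), of h] h ist cs by (metis Fs(1,2,3))
    have "h \<cdot>\<^bsub>D\<^esub> j = v \<cdot>\<^bsub>D\<^esub> (q \<cdot>\<^bsub>D\<^esub> j)"
      using D.assoc[of j q v] v js(2,3,6,7) qs(2) by simp
    then have "h \<cdot>\<^bsub>D\<^esub> j = Zero D (Src D j) (Tgt D h)"
      using v js by simp
    then show "\<exists>u. u \<in> Arr D \<and> Src D u = Tgt D (on_arr F c) \<and> Tgt D u = Tgt D h \<and> u \<cdot>\<^bsub>D\<^esub> on_arr F c = h"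
      using D.cokernel_factor[OF Fcj h(1)] h js cs by (metis Fs(2,3))
  qed
qed

section \<open>Adjunctions and modules\<close>

locale adjunction =
  fixes A :: "('o, 'm, 'x) cat_scheme" and B :: "('p, 'n, 'y) cat_scheme"
    and F :: "('o, 'm, 'p, 'n) ftor" and U :: "('p, 'n, 'o, 'm) ftor"
    and \<eta> :: "'o \<Rightarrow> 'm" and \<epsilon> :: "'p \<Rightarrow> 'n"
  assumes adj: "adjoint_pair A B F U \<eta> \<epsilon>"
begin

abbreviation "M \<equiv> adj_monad F U \<eta> \<epsilon>"

lemma F_functor: "is_functor A B F"
  and U_functor: "is_functor B A U"
  using adj by (simp_all add: adjoint_pair_def)

sublocale A: category A by (rule is_functorD(1)[OF F_functor])
sublocale B: category B by (rule is_functorD(1)[OF U_functor])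

lemmas functor_simps [simp] =
  functor_arr[OF F_functor] functor_comp[OF F_functor] is_functorD(3,5)[OF F_functor]
  functor_arr[OF U_functor] functor_comp[OF U_functor] is_functorD(3,5)[OF U_functor]

lemma eta_arr [simp]:
  assumes "X \<in> Obj A"
  shows "\<eta> X \<in> Arr A" "Src A (\<eta> X) = X" "Tgt A (\<eta> X) = on_obj U (on_obj F X)"
proof -
  have "nat_trans A A id_ftor (U \<circ>\<^sub>F F) \<eta>" using adj by (simp add: adjoint_pair_def)
  from nat_transD(3)[OF this assms]
  show "\<eta> X \<in> Arr A" "Src A (\<eta> X) = X" "Tgt A (\<eta> X) = on_obj U (on_obj F X)"
    by (simp_all add: Hom_def)
qed

lemma eps_arr [simp]:
  assumes "Y \<in> Obj B"
  shows "\<epsilon> Y \<in> Arr B" "Src B (\<epsilon> Y) = on_obj F (on_obj U Y)" "Tgt B (\<epsilon> Y) = Y"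
proof -
  have "nat_trans B B (F \<circ>\<^sub>F U) id_ftor \<epsilon>" using adj by (simp add: adjoint_pair_def)
  from nat_transD(3)[OF this assms]
  show "\<epsilon> Y \<in> Arr B" "Src B (\<epsilon> Y) = on_obj F (on_obj U Y)" "Tgt B (\<epsilon> Y) = Y"
    by (simp_all add: Hom_def)
qed

lemma eta_nat:
  assumes "f \<in> Arr A"
  shows "\<eta> (Tgt A f) \<cdot>\<^bsub>A\<^esub> f = on_arr U (on_arr F f) \<cdot>\<^bsub>A\<^esub> \<eta> (Src A f)"
proof -
  have "nat_trans A A id_ftor (U \<circ>\<^sub>F F) \<eta>" using adj by (simp add: adjoint_pair_def)
  from nat_transD(4)[OF this, of f "Src A f" "Tgt A f"] show ?thesis
    using assms by (simp add: Hom_def)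
qed

lemma eps_nat:
  assumes "g \<in> Arr B"
  shows "\<epsilon> (Tgt B g) \<cdot>\<^bsub>B\<^esub> on_arr F (on_arr U g) = g \<cdot>\<^bsub>B\<^esub> \<epsilon> (Src B g)"
proof -
  have "nat_trans B B (F \<circ>\<^sub>F U) id_ftor \<epsilon>" using adj by (simp add: adjoint_pair_def)
  from nat_transD(4)[OF this, of g "Src B g" "Tgt B g"] show ?thesis
    using assms by (simp add: Hom_def)
qed

lemma U_eps_nat:
  assumes "g \<in> Arr B"
  shows "on_arr U (\<epsilon> (Tgt B g)) \<cdot>\<^bsub>A\<^esub> on_arr U (on_arr F (on_arr U g))
    = on_arr U g \<cdot>\<^bsub>A\<^esub> on_arr U (\<epsilon> (Src B g))"
  using arg_cong[OF eps_nat[OF assms], of "on_arr U"] assms by simp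

lemma triangle_F: "X \<in> Obj A \<Longrightarrow> \<epsilon> (on_obj F X) \<cdot>\<^bsub>B\<^esub> on_arr F (\<eta> X) = Ide B (on_obj F X)"
  and triangle_U: "Y \<in> Obj B \<Longrightarrow> on_arr U (\<epsilon> Y) \<cdot>\<^bsub>A\<^esub> \<eta> (on_obj U Y) = Ide A (on_obj U Y)"
  using adj by (auto simp: adjoint_pair_def)

lemma module_iff:
  "(X, l) \<in> modules A M \<longleftrightarrow> X \<in> Obj A \<and> l \<in> Arr A \<and> Src A l = on_obj U (on_obj F X) \<and> Tgt A l = X
     \<and> l \<cdot>\<^bsub>A\<^esub> on_arr U (on_arr F l) = l \<cdot>\<^bsub>A\<^esub> on_arr U (\<epsilon> (on_obj F X))
     \<and> l \<cdot>\<^bsub>A\<^esub> \<eta> X = Ide A X"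
  by (auto simp: modules_def adj_monad_def Hom_def)

text \<open>Associativity of the action is naturality of \<open>\<epsilon>\<close> at the arrow
  \<open>\<epsilon> Y\<close>; the unit law is a triangle identity.\<close>

lemma comparison_obj_module:
  assumes "Y \<in> Obj B"
  shows "comparison_obj U \<epsilon> Y \<in> modules A M"
  using assms U_eps_nat[of "\<epsilon> Y"] triangle_U[OF assms]
  by (simp add: comparison_obj_def module_iff)

text \<open>Everything rests on \<open>(U c \<cdot> \<eta> X) \<cdot> l = U c\<close>. Naturality of
  \<open>\<eta>\<close> moves it past \<open>l\<close>, the coequalizing equation replaces
  \<open>F l\<close> by \<open>\<epsilon> (F X)\<close>, and a triangle identity removes the rest.
  The second inverse law then follows by cancelling the epi \<open>U c\<close>.\<close>

lemma module_coequalizer: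
  assumes Xl: "(X, l) \<in> modules A M"
    and c: "c \<in> Arr B" "Src B c = on_obj F X" "Tgt B c = Z"
    and coeq: "c \<cdot>\<^bsub>B\<^esub> on_arr F l = c \<cdot>\<^bsub>B\<^esub> \<epsilon> (on_obj F X)"
    and epi: "is_epi A (on_arr U c)"
    and \<phi>: "\<phi> \<in> Hom A (on_obj U Z) X" "\<phi> \<cdot>\<^bsub>A\<^esub> on_arr U c = l"
  shows "\<phi> \<cdot>\<^bsub>A\<^esub> (on_arr U c \<cdot>\<^bsub>A\<^esub> \<eta> X) = Ide A X"
    and "(on_arr U c \<cdot>\<^bsub>A\<^esub> \<eta> X) \<cdot>\<^bsub>A\<^esub> \<phi> = Ide A (on_obj U Z)"
    and "(on_arr U c \<cdot>\<^bsub>A\<^esub> \<eta> X) \<cdot>\<^bsub>A\<^esub> l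
      = on_arr U (\<epsilon> Z) \<cdot>\<^bsub>A\<^esub> on_arr U (on_arr F (on_arr U c \<cdot>\<^bsub>A\<^esub> \<eta> X))"
proof -
  have X: "X \<in> Obj A" and l: "l \<in> Arr A" "Src A l = on_obj U (on_obj F X)" "Tgt A l = X"
    and unit: "l \<cdot>\<^bsub>A\<^esub> \<eta> X = Ide A X"
    using Xl by (auto simp: module_iff)
  have Z: "Z \<in> Obj B" using c by auto
  have \<phi>': "\<phi> \<in> Arr A" "Src A \<phi> = on_obj U Z" "Tgt A \<phi> = X" using \<phi>(1) by (auto simp: Hom_def)
  have Ucoeq: "on_arr U c \<cdot>\<^bsub>A\<^esub> on_arr U (on_arr F l) = on_arr U c \<cdot>\<^bsub>A\<^esub> on_arr U (\<epsilon> (on_obj F X))"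
    using arg_cong[OF coeq, of "on_arr U"] c l X by simp
  have "(on_arr U c \<cdot>\<^bsub>A\<^esub> \<eta> X) \<cdot>\<^bsub>A\<^esub> l
      = (on_arr U c \<cdot>\<^bsub>A\<^esub> on_arr U (on_arr F l)) \<cdot>\<^bsub>A\<^esub> \<eta> (on_obj U (on_obj F X))"
    using eta_nat[OF l(1)] l c X by (simp add: A.assoc)
  also have "\<dots> = on_arr U c"
    using triangle_U[of "on_obj F X"] c X by (simp add: Ucoeq A.assoc)
  finally have \<psi>l: "(on_arr U c \<cdot>\<^bsub>A\<^esub> \<eta> X) \<cdot>\<^bsub>A\<^esub> l = on_arr U c" .
  show "\<phi> \<cdot>\<^bsub>A\<^esub> (on_arr U c \<cdot>\<^bsub>A\<^esub> \<eta> X) = Ide A X"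
    using A.assoc[of "\<eta> X" "on_arr U c" \<phi>] \<phi> \<phi>' c X unit by simp
  show "(on_arr U c \<cdot>\<^bsub>A\<^esub> \<eta> X) \<cdot>\<^bsub>A\<^esub> \<phi> = Ide A (on_obj U Z)"
  proof (rule A.epiD[OF epi])
    show "((on_arr U c \<cdot>\<^bsub>A\<^esub> \<eta> X) \<cdot>\<^bsub>A\<^esub> \<phi>) \<cdot>\<^bsub>A\<^esub> on_arr U c = Ide A (on_obj U Z) \<cdot>\<^bsub>A\<^esub> on_arr U c"
      using A.assoc[of "on_arr U c" \<phi> "on_arr U c \<cdot>\<^bsub>A\<^esub> \<eta> X"] \<psi>l \<phi>(2) \<phi>' c X by simp
  qed (use \<phi>' c X Z in simp_all)
  \<comment> \<open>The other side of the module equation also collapses to \<open>U c\<close>, by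
    naturality of \<open>\<epsilon>\<close> at \<open>c\<close> and the other triangle
    identity.\<close>
  have "on_arr U (\<epsilon> Z) \<cdot>\<^bsub>A\<^esub> on_arr U (on_arr F (on_arr U c \<cdot>\<^bsub>A\<^esub> \<eta> X))
      = (on_arr U (\<epsilon> Z) \<cdot>\<^bsub>A\<^esub> on_arr U (on_arr F (on_arr U c))) \<cdot>\<^bsub>A\<^esub> on_arr U (on_arr F (\<eta> X))"
    using c X Z by (simp add: A.assoc)
  also have "\<dots> = on_arr U c \<cdot>\<^bsub>A\<^esub> on_arr U (\<epsilon> (on_obj F X) \<cdot>\<^bsub>B\<^esub> on_arr F (\<eta> X))"
    using U_eps_nat[OF c(1)] c X by (simp add: A.assoc)
  also have "\<dots> = on_arr U c" using triangle_F[OF X] c X by simp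
  finally show "(on_arr U c \<cdot>\<^bsub>A\<^esub> \<eta> X) \<cdot>\<^bsub>A\<^esub> l
      = on_arr U (\<epsilon> Z) \<cdot>\<^bsub>A\<^esub> on_arr U (on_arr F (on_arr U c \<cdot>\<^bsub>A\<^esub> \<eta> X))"
    using \<psi>l by simp
qed

text \<open>An inverse in \<open>A\<close> respects the actions: insert the image of
  \<open>f \<cdot> g\<close> after \<open>l'\<close>, move \<open>f\<close> across the actions, and
  cancel \<open>g \<cdot> f\<close>. The result concerns \<open>g\<close> because essential
  surjectivity asks for an isomorphism into the given module.\<close>

lemma module_iso:
  assumes P: "P \<in> modules A M" and Q: "Q \<in> modules A M"
    and f: "is_module_morphism A M P Q f"
    and g: "g \<in> Hom A (fst Q) (fst P)" "g \<cdot>\<^bsub>A\<^esub> f = Ide A (fst P)" "f \<cdot>\<^bsub>A\<^esub> g = Ide A (fst Q)"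
  shows "(Q, g, P) \<in> Hom (Mod_cat A M) Q P" "is_iso (Mod_cat A M) (Q, g, P)"
proof -
  obtain X l X' l' where e: "P = (X, l)" "Q = (X', l')" by (cases P, cases Q)
  have l: "X \<in> Obj A" "l \<in> Arr A" "Src A l = on_obj U (on_obj F X)" "Tgt A l = X"
    and l': "X' \<in> Obj A" "l' \<in> Arr A" "Src A l' = on_obj U (on_obj F X')" "Tgt A l' = X'"
    using P Q by (auto simp: module_iff e)
  have f': "f \<in> Arr A" "Src A f = X" "Tgt A f = X'" "f \<cdot>\<^bsub>A\<^esub> l = l' \<cdot>\<^bsub>A\<^esub> on_arr U (on_arr F f)"
    using f by (auto simp: is_module_morphism_def e Hom_def adj_monad_def)
  have g': "g \<in> Arr A" "Src A g = X'" "Tgt A g = X" using g by (auto simp: e Hom_def)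
  have gf: "g \<cdot>\<^bsub>A\<^esub> f = Ide A X" "f \<cdot>\<^bsub>A\<^esub> g = Ide A X'" using g by (simp_all add: e)
  have "on_arr U (on_arr F (f \<cdot>\<^bsub>A\<^esub> g)) = Ide A (on_obj U (on_obj F X'))"
    using gf l' by simp
  then have UFfg: "on_arr U (on_arr F f) \<cdot>\<^bsub>A\<^esub> on_arr U (on_arr F g) = Ide A (on_obj U (on_obj F X'))"
    using f'(1-3) g' by simp
  have "g \<cdot>\<^bsub>A\<^esub> l' = g \<cdot>\<^bsub>A\<^esub> ((l' \<cdot>\<^bsub>A\<^esub> on_arr U (on_arr F f)) \<cdot>\<^bsub>A\<^esub> on_arr U (on_arr F g))"
    using f'(1-3) g' l' UFfg by (simp add: A.assoc)
  also have "\<dots> = (g \<cdot>\<^bsub>A\<^esub> f) \<cdot>\<^bsub>A\<^esub> (l \<cdot>\<^bsub>A\<^esub> on_arr U (on_arr F g))"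
    using f'(1-3) g' l by (simp add: A.assoc flip: f'(4))
  also have "\<dots> = l \<cdot>\<^bsub>A\<^esub> on_arr U (on_arr F g)"
    using gf g' l by simp
  finally have g_mor: "is_module_morphism A M Q P g"
    using g by (simp add: is_module_morphism_def e adj_monad_def)
  then show gh: "(Q, g, P) \<in> Hom (Mod_cat A M) Q P"
    using P Q by (simp add: in_Hom_Mod_cat)
  interpret Mod: category "Mod_cat A M"
    by (rule category_Mod_cat[OF adj_monad_is_monad[OF adj]])
  show "is_iso (Mod_cat A M) (Q, g, P)"
    by (rule Mod.is_isoI[OF gh, of "(P, f, Q)"]) (use P Q f g in \<open>simp_all add: in_Hom_Mod_cat\<close>)
qed

end

section \<open>Abelian categories with an exact right adjoint\<close>

locale exact_adjunction = adjunction A B F U \<eta> \<epsilon>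
  for A :: "('o, 'm, 'x) addcat_scheme" and B :: "('p, 'n, 'y) addcat_scheme" and F U \<eta> \<epsilon> +
  assumes A_abelian: "abelian_category A" and B_abelian: "abelian_category B"
    and U_exact: "exact_functor B A U"
begin

sublocale A: abelian_category A by (rule A_abelian)
sublocale B: abelian_category B by (rule B_abelian)

text \<open>Common source of essential surjectivity and fullness: the former uses the inverse pair
  in \<open>A\<close>, the latter, for modules of the form \<open>K Y\<close>, also the
  factorization property in \<open>B\<close>.\<close>

lemma module_presentation:
  assumes Xl: "(X, l) \<in> modules A M"
  obtains Z c \<phi> where "Z \<in> Obj B" "c \<in> Hom B (on_obj F X) Z"
    and "\<And>W h. \<lbrakk>h \<in> Hom B (on_obj F X) W; h \<cdot>\<^bsub>B\<^esub> on_arr F l = h \<cdot>\<^bsub>B\<^esub> \<epsilon> (on_obj F X)\<rbrakk>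
      \<Longrightarrow> \<exists>u\<in>Hom B Z W. u \<cdot>\<^bsub>B\<^esub> c = h"
    and "\<phi> \<in> Hom A (on_obj U Z) X" "\<phi> \<cdot>\<^bsub>A\<^esub> on_arr U c = l"
    and "\<phi> \<cdot>\<^bsub>A\<^esub> (on_arr U c \<cdot>\<^bsub>A\<^esub> \<eta> X) = Ide A X"
    and "(on_arr U c \<cdot>\<^bsub>A\<^esub> \<eta> X) \<cdot>\<^bsub>A\<^esub> \<phi> = Ide A (on_obj U Z)"
    and "(on_arr U c \<cdot>\<^bsub>A\<^esub> \<eta> X) \<cdot>\<^bsub>A\<^esub> l
      = on_arr U (\<epsilon> Z) \<cdot>\<^bsub>A\<^esub> on_arr U (on_arr F (on_arr U c \<cdot>\<^bsub>A\<^esub> \<eta> X))"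
proof -
  let ?T = "\<lambda>X. on_obj U (on_obj F X)"
  have X: "X \<in> Obj A" and l: "l \<in> Arr A" "Src A l = ?T X" "Tgt A l = X"
    and act: "l \<cdot>\<^bsub>A\<^esub> on_arr U (on_arr F l) = l \<cdot>\<^bsub>A\<^esub> on_arr U (\<epsilon> (on_obj F X))"
    using Xl by (auto simp: module_iff)
  have add: "additive_functor B A U" using U_exact by (simp add: exact_functor_def)
  have H: "on_arr F l \<in> Hom B (on_obj F (?T X)) (on_obj F X)"
    "\<epsilon> (on_obj F X) \<in> Hom B (on_obj F (?T X)) (on_obj F X)"
    using l X by (simp_all add: Hom_def)
  \<comment> \<open>\<open>d\<close> stands for \<open>F l - \<epsilon> (F X)\<close>.\<close>
  obtain d where d: "d \<in> Hom B (on_obj F (?T X)) (on_obj F X)"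
    and dsum: "d \<boxplus>\<^bsub>B\<^esub> \<epsilon> (on_obj F X) = on_arr F l"
    using B.ex_diff[OF H] by blast
  have d': "d \<in> Arr B" "Src B d = on_obj F (?T X)" "Tgt B d = on_obj F X"
    using d by (auto simp: Hom_def)
  obtain c where c: "is_cokernel B c d" using B.cokernels[OF d'(1)] by blast
  note cs = B.cokernelD[OF c]
  have Uc: "is_cokernel A (on_arr U c) (on_arr U d)"
    by (rule exact_functor_cokernel[OF B_abelian A_abelian U_exact c])
  define Z where "Z = Tgt B c"
  have c': "c \<in> Hom B (on_obj F X) Z" "Z \<in> Obj B" using cs d' by (auto simp: Hom_def Z_def)
  have coeq: "c \<cdot>\<^bsub>B\<^esub> on_arr F l = c \<cdot>\<^bsub>B\<^esub> \<epsilon> (on_obj F X)"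
    using B.comp_diff_zero_iff[OF d H dsum c'(1)] cs d' by (simp add: Z_def)
  have fac: "\<exists>u\<in>Hom B Z W. u \<cdot>\<^bsub>B\<^esub> c = h"
    if h: "h \<in> Hom B (on_obj F X) W" "h \<cdot>\<^bsub>B\<^esub> on_arr F l = h \<cdot>\<^bsub>B\<^esub> \<epsilon> (on_obj F X)" for W h
  proof -
    have "h \<cdot>\<^bsub>B\<^esub> d = Zero B (on_obj F (?T X)) W"
      using B.comp_diff_zero_iff[OF d H dsum h(1)] h(2) by simp
    then have "h \<in> Arr B" "Src B h = Tgt B d" "Tgt B h = W" "h \<cdot>\<^bsub>B\<^esub> d = Zero B (Src B d) (Tgt B h)"
      using h(1) d' by (auto simp: Hom_def)
    then show ?thesis using B.cokernel_factor[OF c, of h] by (auto simp: Hom_def Z_def)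
  qed
  have UH: "on_arr U d \<in> Hom A (?T (?T X)) (?T X)" "on_arr U (on_arr F l) \<in> Hom A (?T (?T X)) (?T X)"
    "on_arr U (\<epsilon> (on_obj F X)) \<in> Hom A (?T (?T X)) (?T X)" "l \<in> Hom A (?T X) X"
    using d' l X by (simp_all add: Hom_def)
  have "on_arr U d \<boxplus>\<^bsub>A\<^esub> on_arr U (\<epsilon> (on_obj F X)) = on_arr U (on_arr F l)"
    using additive_functor_plus[OF add d H(2)] dsum by simp
  \<comment> \<open>By additivity \<open>U d\<close> is the difference of the two images, and
    associativity of the action says that \<open>l\<close> coequalizes them; so \<open>l\<close>
    factors through the cokernel \<open>U c\<close>.\<close>
  then have "l \<cdot>\<^bsub>A\<^esub> on_arr U d = Zero A (?T (?T X)) X"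
    using A.comp_diff_zero_iff[OF UH(1-3) _ UH(4)] act by simp
  then obtain \<phi> where \<phi>: "\<phi> \<in> Hom A (on_obj U Z) X" "\<phi> \<cdot>\<^bsub>A\<^esub> on_arr U c = l"
    using A.cokernel_factor[OF Uc, of l] l d' cs by (auto simp: Hom_def Z_def)
  have cZ: "Src B c = on_obj F X" "Tgt B c = Z" using c'(1) by (simp_all add: Hom_def)
  show ?thesis
    by (rule that[OF c'(2) c'(1) fac \<phi>
          module_coequalizer[OF Xl cs(2) cZ coeq A.cokernel_epi[OF Uc] \<phi>]])
qed

text \<open>The isomorphism is \<open>\<phi>\<close>, whose inverse
  \<open>U c \<cdot> \<eta> X\<close> is a module morphism by the presentation.\<close>

lemma comparison_ess_surj:
  assumes "P \<in> modules A M"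
  shows "\<exists>Z\<in>Obj B. \<exists>e\<in>Hom (Mod_cat A M) (comparison_obj U \<epsilon> Z) P. is_iso (Mod_cat A M) e"
proof -
  obtain X l where P: "P = (X, l)" "(X, l) \<in> modules A M" using assms by (cases P) auto
  obtain Z c \<phi> where Z: "Z \<in> Obj B" and c: "c \<in> Hom B (on_obj F X) Z"
    and \<phi>: "\<phi> \<in> Hom A (on_obj U Z) X"
    and inv: "\<phi> \<cdot>\<^bsub>A\<^esub> (on_arr U c \<cdot>\<^bsub>A\<^esub> \<eta> X) = Ide A X"
      "(on_arr U c \<cdot>\<^bsub>A\<^esub> \<eta> X) \<cdot>\<^bsub>A\<^esub> \<phi> = Ide A (on_obj U Z)"
    and mor: "(on_arr U c \<cdot>\<^bsub>A\<^esub> \<eta> X) \<cdot>\<^bsub>A\<^esub> l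
      = on_arr U (\<epsilon> Z) \<cdot>\<^bsub>A\<^esub> on_arr U (on_arr F (on_arr U c \<cdot>\<^bsub>A\<^esub> \<eta> X))"
    using module_presentation[OF P(2)] by metis
  have "X \<in> Obj A" using P(2) by (simp add: module_iff)
  then have "on_arr U c \<cdot>\<^bsub>A\<^esub> \<eta> X \<in> Hom A X (on_obj U Z)"
    using c by (simp add: Hom_def)
  then have "is_module_morphism A M P (comparison_obj U \<epsilon> Z) (on_arr U c \<cdot>\<^bsub>A\<^esub> \<eta> X)"
    using mor by (simp add: is_module_morphism_def P comparison_obj_def adj_monad_def)
  from module_iso[OF assms comparison_obj_module[OF Z] this, of \<phi>] show ?thesis
    using Z \<phi> inv by (auto simp: P comparison_obj_def)
qed

text \<open>The transpose of \<open>f\<close> under the adjunction is factored through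
  \<open>\<epsilon> Y\<close>, which is possible once \<open>\<epsilon> Y\<close> is identified with
  the presenting coequalizer of \<open>K Y\<close>.\<close>

lemma comparison_full:
  assumes faithful: "faithful_functor B A U" and Y: "Y \<in> Obj B" "Y' \<in> Obj B"
    and f: "is_module_morphism A M (comparison_obj U \<epsilon> Y) (comparison_obj U \<epsilon> Y') f"
  shows "\<exists>g\<in>Hom B Y Y'. on_arr U g = f"
proof -
  have f': "f \<in> Arr A" "Src A f = on_obj U Y" "Tgt A f = on_obj U Y'"
    and feq: "f \<cdot>\<^bsub>A\<^esub> on_arr U (\<epsilon> Y) = on_arr U (\<epsilon> Y') \<cdot>\<^bsub>A\<^esub> on_arr U (on_arr F f)"
    using f by (auto simp: is_module_morphism_def comparison_obj_def Hom_def adj_monad_def)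
  let ?X = "on_obj U Y"
  have "(?X, on_arr U (\<epsilon> Y)) \<in> modules A M"
    using comparison_obj_module[OF Y(1)] by (simp add: comparison_obj_def)
  from module_presentation[OF this]
  obtain Z c \<phi> where Z: "Z \<in> Obj B" and c: "c \<in> Hom B (on_obj F ?X) Z"
    and fac: "\<And>W h. \<lbrakk>h \<in> Hom B (on_obj F ?X) W;
        h \<cdot>\<^bsub>B\<^esub> on_arr F (on_arr U (\<epsilon> Y)) = h \<cdot>\<^bsub>B\<^esub> \<epsilon> (on_obj F ?X)\<rbrakk>
      \<Longrightarrow> \<exists>u\<in>Hom B Z W. u \<cdot>\<^bsub>B\<^esub> c = h"
    and \<phi>: "\<phi> \<in> Hom A (on_obj U Z) ?X"
    and inv: "\<phi> \<cdot>\<^bsub>A\<^esub> (on_arr U c \<cdot>\<^bsub>A\<^esub> \<eta> ?X) = Ide A ?X"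
      "(on_arr U c \<cdot>\<^bsub>A\<^esub> \<eta> ?X) \<cdot>\<^bsub>A\<^esub> \<phi> = Ide A (on_obj U Z)"
    by metis
  have c': "c \<in> Arr B" "Src B c = on_obj F ?X" "Tgt B c = Z" using c by (auto simp: Hom_def)
  have \<phi>': "\<phi> \<in> Arr A" "Src A \<phi> = on_obj U Z" "Tgt A \<phi> = ?X" using \<phi> by (auto simp: Hom_def)
  have eps: "\<epsilon> Y \<in> Hom B (on_obj F ?X) Y" using Y by (simp add: Hom_def)
  have eps_coeq: "\<epsilon> Y \<cdot>\<^bsub>B\<^esub> on_arr F (on_arr U (\<epsilon> Y)) = \<epsilon> Y \<cdot>\<^bsub>B\<^esub> \<epsilon> (on_obj F ?X)"
    using eps_nat[of "\<epsilon> Y"] Y by simp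
  obtain u where u: "u \<in> Hom B Z Y" and uc: "u \<cdot>\<^bsub>B\<^esub> c = \<epsilon> Y" using fac[OF eps eps_coeq] by blast
  have u': "u \<in> Arr B" "Src B u = Z" "Tgt B u = Y" using u by (auto simp: Hom_def)
  have Uuc: "on_arr U u \<cdot>\<^bsub>A\<^esub> on_arr U c = on_arr U (\<epsilon> Y)"
    using functor_comp[OF U_functor, of c u] u' c' uc by simp
  \<comment> \<open>Composing with the identity of \<open>U Z\<close> in its factored form leaves
    \<open>\<phi>\<close>, since \<open>U u \<cdot> U c\<close> is \<open>U (\<epsilon> Y)\<close>,
    which \<open>\<eta>\<close> splits.\<close>
  have "on_arr U u = on_arr U u \<cdot>\<^bsub>A\<^esub> ((on_arr U c \<cdot>\<^bsub>A\<^esub> \<eta> ?X) \<cdot>\<^bsub>A\<^esub> \<phi>)"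
    using inv u' by simp
  also have "\<dots> = ((on_arr U u \<cdot>\<^bsub>A\<^esub> on_arr U c) \<cdot>\<^bsub>A\<^esub> \<eta> ?X) \<cdot>\<^bsub>A\<^esub> \<phi>"
    using u' c' \<phi>' Y by (simp add: A.assoc)
  also have "\<dots> = \<phi>"
    using Uuc triangle_U[OF Y(1)] \<phi>' by simp
  finally have Uu: "on_arr U u = \<phi>" .
  have "is_iso A \<phi>"
    by (rule A.is_isoI[OF \<phi>, of "on_arr U c \<cdot>\<^bsub>A\<^esub> \<eta> ?X"]) (use c' Y inv in \<open>auto simp: Hom_def\<close>)
  then have "is_mono B u" "is_epi B u"
    using faithful_reflects_mono_epi[OF faithful u'(1)] A.iso_mono A.iso_epi by (simp_all add: Uu)
  then have "is_iso B u" by (rule B.mono_epi_iso)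
  then obtain v where v: "v \<in> Hom B Y Z" "v \<cdot>\<^bsub>B\<^esub> u = Ide B Z" using B.is_isoE[OF _ u] by blast
  have v': "v \<in> Arr B" "Src B v = Y" "Tgt B v = Z" using v by (auto simp: Hom_def)
  \<comment> \<open>The transpose of \<open>f\<close>. That it coequalizes the pair presenting
    \<open>K Y\<close> combines the module equation for \<open>f\<close> with naturality of
    \<open>\<epsilon>\<close> at \<open>\<epsilon> Y'\<close> and at \<open>F f\<close>.\<close>
  let ?h = "\<epsilon> Y' \<cdot>\<^bsub>B\<^esub> on_arr F f"
  have h: "?h \<in> Hom B (on_obj F ?X) Y'" using f' Y by (simp add: Hom_def)
  have "?h \<cdot>\<^bsub>B\<^esub> on_arr F (on_arr U (\<epsilon> Y)) = \<epsilon> Y' \<cdot>\<^bsub>B\<^esub> on_arr F (f \<cdot>\<^bsub>A\<^esub> on_arr U (\<epsilon> Y))"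
    using f' Y by (simp add: B.assoc)
  also have "\<dots> = (\<epsilon> Y' \<cdot>\<^bsub>B\<^esub> on_arr F (on_arr U (\<epsilon> Y'))) \<cdot>\<^bsub>B\<^esub> on_arr F (on_arr U (on_arr F f))"
    using f' Y by (simp add: feq B.assoc)
  also have "\<dots> = \<epsilon> Y' \<cdot>\<^bsub>B\<^esub> (\<epsilon> (on_obj F (on_obj U Y')) \<cdot>\<^bsub>B\<^esub> on_arr F (on_arr U (on_arr F f)))"
    using eps_nat[of "\<epsilon> Y'"] f' Y by (simp add: B.assoc)
  also have "\<dots> = ?h \<cdot>\<^bsub>B\<^esub> \<epsilon> (on_obj F ?X)"
    using eps_nat[of "on_arr F f"] f' Y by (simp add: B.assoc)
  finally obtain w where w: "w \<in> Hom B Z Y'" "w \<cdot>\<^bsub>B\<^esub> c = ?h" using fac[OF h] by blast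
  have w': "w \<in> Arr B" "Src B w = Z" "Tgt B w = Y'" using w by (auto simp: Hom_def)
  \<comment> \<open>As \<open>u \<cdot> c\<close> is \<open>\<epsilon> Y\<close>, precomposing
    \<open>w\<close> with the inverse \<open>v\<close> of \<open>u\<close> turns a factorization
    through \<open>c\<close> into one through \<open>\<epsilon> Y\<close>.\<close>
  define g where "g = w \<cdot>\<^bsub>B\<^esub> v"
  have g: "g \<in> Arr B" "Src B g = Y" "Tgt B g = Y'" using w' v' by (simp_all add: g_def)
  have "g \<cdot>\<^bsub>B\<^esub> \<epsilon> Y = w \<cdot>\<^bsub>B\<^esub> ((v \<cdot>\<^bsub>B\<^esub> u) \<cdot>\<^bsub>B\<^esub> c)"
    using w' v' u' c' by (simp add: g_def B.assoc flip: uc)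
  also have "\<dots> = ?h" using v(2) w(2) c' by simp
  finally have "on_arr U (g \<cdot>\<^bsub>B\<^esub> \<epsilon> Y) = on_arr U ?h" by simp
  then have Ug: "on_arr U g \<cdot>\<^bsub>A\<^esub> on_arr U (\<epsilon> Y) = on_arr U (\<epsilon> Y') \<cdot>\<^bsub>A\<^esub> on_arr U (on_arr F f)"
    using g f' Y by simp
  \<comment> \<open>\<open>U (\<epsilon> Y)\<close> has the right inverse
    \<open>\<eta> (U Y)\<close>, so it can be cancelled on the right.\<close>
  have "on_arr U g = (on_arr U g \<cdot>\<^bsub>A\<^esub> on_arr U (\<epsilon> Y)) \<cdot>\<^bsub>A\<^esub> \<eta> ?X"
    using g Y triangle_U[OF Y(1)] by (simp add: A.assoc)
  also have "\<dots> = (f \<cdot>\<^bsub>A\<^esub> on_arr U (\<epsilon> Y)) \<cdot>\<^bsub>A\<^esub> \<eta> ?X" by (simp only: Ug feq)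
  also have "\<dots> = f"
    using f' Y triangle_U[OF Y(1)] by (simp add: A.assoc)
  finally show ?thesis using g by (auto simp: Hom_def)
qed

end

text \<open>For parallel arrows the endpoints stored in their images under \<open>K\<close> agree,
  so only the middle components \<open>U f\<close> and \<open>U g\<close> are compared.\<close>

lemma comparison_faithful_iff:
  assumes "adjoint_pair A B F U \<eta> \<epsilon>"
  shows "faithful_functor B (Mod_cat A (adj_monad F U \<eta> \<epsilon>)) (comparison B U \<epsilon>)
    \<longleftrightarrow> faithful_functor B A U"
proof -
  have "is_functor B A U" using assms by (simp add: adjoint_pair_def)
  moreover have "on_arr (comparison B U \<epsilon>) f = on_arr (comparison B U \<epsilon>) g
      \<longleftrightarrow> on_arr U f = on_arr U g" if "f \<in> Hom B X Y" "g \<in> Hom B X Y" for f g X Y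
    using that by (auto simp: comparison_def Hom_def)
  ultimately show ?thesis
    using comparison_is_functor[OF assms] unfolding faithful_functor_def inj_on_def by blast
qed

theorem theorem2p1:
  fixes A :: "('o, 'm, 'x) addcat_scheme"
    and B :: "('p, 'n, 'y) addcat_scheme"
    and F :: "('o, 'm, 'p, 'n) ftor"
    and U :: "('p, 'n, 'o, 'm) ftor"
    and \<eta> :: "'o \<Rightarrow> 'm"
    and \<epsilon> :: "'p \<Rightarrow> 'n"
  assumes "abelian_category A"
    and "abelian_category B"
    and "additive_functor A B F"
    and "adjoint_pair A B F U \<eta> \<epsilon>"
    and "exact_functor B A U"
  shows "equivalence_functor B (Mod_cat A (adj_monad F U \<eta> \<epsilon>)) (comparison B U \<epsilon>)
           \<longleftrightarrow> faithful_functor B A U"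
proof
  assume "equivalence_functor B (Mod_cat A (adj_monad F U \<eta> \<epsilon>)) (comparison B U \<epsilon>)"
  then show "faithful_functor B A U"
    using equivalence_functor_faithful comparison_faithful_iff[OF assms(4)] by blast
next
  assume U: "faithful_functor B A U"
  interpret exact_adjunction A B F U \<eta> \<epsilon>
    by (intro exact_adjunction.intro adjunction.intro exact_adjunction_axioms.intro assms)
  show "equivalence_functor B (Mod_cat A M) (comparison B U \<epsilon>)"
  proof (rule equivalence_functorI)
    show "faithful_functor B (Mod_cat A M) (comparison B U \<epsilon>)"
      using U comparison_faithful_iff[OF assms(4)] by blast
  next
    fix Y Y' a assume Y: "Y \<in> Obj B" "Y' \<in> Obj B"
      and a: "a \<in> Hom (Mod_cat A M) (on_obj (comparison B U \<epsilon>) Y) (on_obj (comparison B U \<epsilon>) Y')"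
    \<comment> \<open>The middle component of \<open>a\<close> is lifted to \<open>B\<close>; its
      outer components are already those of the image of the lift.\<close>
    obtain f where f: "a = (comparison_obj U \<epsilon> Y, f, comparison_obj U \<epsilon> Y')"
      "is_module_morphism A M (comparison_obj U \<epsilon> Y) (comparison_obj U \<epsilon> Y') f"
      using a by (auto simp: in_Hom_Mod_cat comparison_def)
    obtain g where "g \<in> Hom B Y Y'" "on_arr U g = f" using comparison_full[OF U Y f(2)] by blast
    then show "\<exists>g\<in>Hom B Y Y'. on_arr (comparison B U \<epsilon>) g = a"
      by (intro bexI[of _ g]) (auto simp: comparison_def f(1) Hom_def)
  next
    fix P assume "P \<in> Obj (Mod_cat A M)"
    then show "\<exists>Z\<in>Obj B. \<exists>e\<in>Hom (Mod_cat A M) (on_obj (comparison B U \<epsilon>) Z) P. is_iso (Mod_cat A M) e"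
      using comparison_ess_surj[of P] by (simp add: comparison_def)
  qed
qed

end
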